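(* There exists a set $A \subseteq \mathbb{N}$ (identified with its characteristic sequence $A \in 2^{\mathbb{N}}$) that is both deep and 1-generic.
   Context: A prefix-free machine $M$ is a partial computable function from $\{0,1\}^*$ to $\{0,1\}^*$ whose domain is prefix-free (no element of the domain is a proper prefix of another). For such $M$, $K_M(x) = \min\{|\sigma| : M(\sigma) = x\}$. A prefix-free machine $R$ is optimal if for every prefix-free machine $M$ there is a constant $d_M$ with $K_R(x) \le K_M(x) + d_M$ for all $x$. Fix an optimal prefix-free machine $\mathbb{U}$ (the paper fixes it by setting $\mathbb{U}(0^{e-1}1\sigma) = M_e(\sigma)$ for an effective enumeration $(M_e)_e$ of prefix-free machines), and write $K = K_{\mathbb{U}}$. For a computable function $t:\mathbb{N}\to\mathbb{N}$, the time-bounded complexity is $K^t(x) = \min\{|\sigma| : \mathbb{U}(\sigma)\downarrow = x \text{ in at most } t(|x|) \text{ steps}\}$. A set $X \in 2^{\mathbb{N}}$ is deep if for every computable time bound $t$ and every $c \in \mathbb{N}$, for all but finitely many $n$ we have $K^t(X\upharpoonright n) - K(X\upharpoonright n) \ge c$. For a set $S$ of finite binary strings, $A$ meets $S$ if some initial segment $A\upharpoonright n$ lies in $S$, and $A$ avoids $S$ if there is $n$ such that no string extending $A\upharpoonright n$ lies in $S$. $A$ is 1-generic if it meets or avoids every computably enumerable ($\Sigma^0_1$) set of strings. *)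

theory Defs
  imports Complex_Main "HOL-Library.Nat_Bijection" "HOL-Library.Sublist" "HOL-Library.Extended_Nat"
begin

text \<open>
  Partial computable functions are the partial recursive functions, presented by programs for
  unary functions on the natural numbers with tuples coded by \<^const>\<open>prod_encode\<close>.
  With \<open>\<langle>a,b\<rangle>\<close> for the pairing,
  \<^item> \<open>Prec p q\<close> is primitive recursion: \<open>\<langle>a,0\<rangle> \<mapsto> p a\<close> and
    \<open>\<langle>a,n+1\<rangle> \<mapsto> q \<langle>a,\<langle>n,r\<rangle>\<rangle>\<close>, where \<open>r\<close> is the value at \<open>\<langle>a,n\<rangle>\<close>;
  \<^item> \<open>Search p\<close> is unbounded search with a starting point: it maps \<open>\<langle>a,m\<rangle>\<close> to the least
    \<open>n \<ge> m\<close> with \<open>p \<langle>a,n\<rangle> = 0\<close>, provided that \<open>p\<close> converges on all \<open>\<langle>a,i\<rangle>\<close> with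
    \<open>m \<le> i \<le> n\<close>. The usual minimisation operator is the case \<open>m = 0\<close>.
\<close>

datatype prog =
    Zero
  | Succ
  | First
  | Second
  | Tuple prog prog
  | Comp prog prog
  | Prec prog prog
  | Search prog

text \<open>
  \<open>runs p x s y\<close>: on input \<open>x\<close> the program \<open>p\<close> halts with output \<open>y\<close> after exactly \<open>s\<close> steps.
  A step is the execution of one program node, so \<open>s\<close> is the number of nodes of the evaluation
  tree. Since depth quantifies over all computable time bounds, a change to any other reasonable
  step count (such as that of Turing machines) does not affect it.
\<close>

inductive runs :: "prog \<Rightarrow> nat \<Rightarrow> nat \<Rightarrow> nat \<Rightarrow> bool" where
  zero: "runs Zero x 1 0"
| succ: "runs Succ x 1 (Suc x)"
| first: "runs First (prod_encode (a, b)) 1 a"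
| second: "runs Second (prod_encode (a, b)) 1 b"
| tuple: "runs p x s a \<Longrightarrow> runs q x s' b \<Longrightarrow>
    runs (Tuple p q) x (Suc (s + s')) (prod_encode (a, b))"
| comp: "runs q x s y \<Longrightarrow> runs p y s' z \<Longrightarrow> runs (Comp p q) x (Suc (s + s')) z"
| prec_0: "runs p a s y \<Longrightarrow> runs (Prec p q) (prod_encode (a, 0)) (Suc s) y"
| prec_Suc: "runs (Prec p q) (prod_encode (a, n)) s r \<Longrightarrow>
    runs q (prod_encode (a, prod_encode (n, r))) s' y \<Longrightarrow>
    runs (Prec p q) (prod_encode (a, Suc n)) (Suc (s + s')) y"
| search_stop: "runs p (prod_encode (a, m)) s 0 \<Longrightarrow>
    runs (Search p) (prod_encode (a, m)) (Suc s) m"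
| search_next: "runs p (prod_encode (a, m)) s (Suc v) \<Longrightarrow>
    runs (Search p) (prod_encode (a, Suc m)) s' n \<Longrightarrow>
    runs (Search p) (prod_encode (a, m)) (Suc (s + s')) n"

lemma runs_deterministic:
  "runs p x s y \<Longrightarrow> runs p x s' y' \<Longrightarrow> s' = s \<and> y' = y"
proof (induction arbitrary: s' y' rule: runs.induct)
  case (zero x)
  then show ?case by (auto elim: runs.cases)
next
  case (succ x)
  then show ?case by (auto elim: runs.cases)
next
  case (first a b)
  then show ?case by (auto elim: runs.cases)
next
  case (second a b)
  then show ?case by (auto elim: runs.cases)
next
  case (tuple p x s a q t b)
  from tuple.prems show ?case
    by (cases rule: runs.cases) (auto dest!: tuple.IH)
next
  case (comp q x s y p t z)
  from comp.prems show ?case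
    by (cases rule: runs.cases) (auto dest!: comp.IH)
next
  case (prec_0 p a s y q)
  from prec_0.prems show ?case
    by (cases rule: runs.cases) (auto dest!: prec_0.IH)
next
  case (prec_Suc p q a n s r t y)
  from prec_Suc.prems show ?case
    by (cases rule: runs.cases) (auto dest!: prec_Suc.IH)
next
  case (search_stop p a m s)
  from search_stop.prems show ?case
    by (cases rule: runs.cases) (use search_stop.IH in fastforce)+
next
  case (search_next p a m s v t n)
  from search_next.prems show ?case
    by (cases rule: runs.cases) (use search_next.IH in fastforce)+
qed

definition computable :: "(nat \<Rightarrow> nat) \<Rightarrow> bool" where
  "computable f \<longleftrightarrow> (\<exists>p. \<forall>n. \<exists>s. runs p n s (f n))"

type_synonym bitstring = "bool list"

text \<open>The dyadic coding, a computable bijection between binary strings and natural numbers.\<close>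

fun str_code :: "bitstring \<Rightarrow> nat" where
  "str_code [] = 0"
| "str_code (b # \<sigma>) = 2 * str_code \<sigma> + (if b then 2 else 1)"

lemma bij_str_code: "bij str_code"
proof (rule bijI)
  show "inj str_code"
  proof (rule injI)
    fix \<sigma> \<tau> :: bitstring
    assume "str_code \<sigma> = str_code \<tau>"
    then show "\<sigma> = \<tau>"
    proof (induction \<sigma> arbitrary: \<tau>)
      case Nil
      then show ?case by (cases \<tau>) (auto split: if_splits)
    next
      case (Cons b \<sigma>)
      obtain b' \<tau>' where \<tau>: "\<tau> = b' # \<tau>'"
        using Cons.prems by (cases \<tau>) (auto split: if_splits)
      have eq: "2 * str_code \<sigma> + (if b then 2 else 1) = 2 * str_code \<tau>' + (if b' then 2 else 1)"
        using Cons.prems \<tau> by simp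
      have "b = b'"
        using eq by (cases b; cases b') (simp_all, presburger+)
      with eq Cons.IH \<tau> show ?case by simp
    qed
  qed
  have "\<exists>\<sigma>. str_code \<sigma> = n" for n
  proof (induction n rule: less_induct)
    case (less n)
    show ?case
    proof (cases "n = 0")
      case True
      then show ?thesis by (intro exI[of _ "[]"]) simp
    next
      case False
      then have "(n - 1) div 2 < n" by simp
      then obtain \<sigma> where "str_code \<sigma> = (n - 1) div 2" using less by blast
      with False have "str_code (even n # \<sigma>) = n" by (simp, presburger)
      then show ?thesis by blast
    qed
  qed
  then show "surj str_code" by (metis surjI surj_def)
qed

definition implements :: "prog \<Rightarrow> (bitstring \<rightharpoonup> bitstring) \<Rightarrow> bool" where
  "implements p M \<longleftrightarrow> (\<forall>\<sigma> x. M \<sigma> = Some x \<longleftrightarrow> (\<exists>s. runs p (str_code \<sigma>) s (str_code x)))"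

definition partial_computable :: "(bitstring \<rightharpoonup> bitstring) \<Rightarrow> bool" where
  "partial_computable M \<longleftrightarrow> (\<exists>p. implements p M)"

definition ce_set :: "bitstring set \<Rightarrow> bool" where
  "ce_set S \<longleftrightarrow> (\<exists>M. partial_computable M \<and> S = dom M)"

definition prefix_free :: "bitstring set \<Rightarrow> bool" where
  "prefix_free D \<longleftrightarrow> (\<forall>\<sigma>\<in>D. \<forall>\<tau>\<in>D. \<not> strict_prefix \<sigma> \<tau>)"

definition prefix_free_machine :: "(bitstring \<rightharpoonup> bitstring) \<Rightarrow> bool" where
  "prefix_free_machine M \<longleftrightarrow> partial_computable M \<and> prefix_free (dom M)"

text \<open>Both complexities are \<^typ>\<open>enat\<close>-valued; a string without a description has complexity
  \<open>\<infinity>\<close>, the infimum of the empty set.\<close>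

definition K :: "(bitstring \<rightharpoonup> bitstring) \<Rightarrow> bitstring \<Rightarrow> enat" where
  "K M x = (INF \<sigma> \<in> {\<sigma>. M \<sigma> = Some x}. enat (length \<sigma>))"

definition K_time :: "prog \<Rightarrow> (nat \<Rightarrow> nat) \<Rightarrow> bitstring \<Rightarrow> enat" where
  "K_time u t x =
    (INF \<sigma> \<in> {\<sigma>. \<exists>s \<le> t (length x). runs u (str_code \<sigma>) s (str_code x)}. enat (length \<sigma>))"

definition optimal :: "(bitstring \<rightharpoonup> bitstring) \<Rightarrow> bool" where
  "optimal R \<longleftrightarrow> prefix_free_machine R \<and>
    (\<forall>M. prefix_free_machine M \<longrightarrow> (\<exists>d::nat. \<forall>x. K R x \<le> K M x + enat d))"

definition restr :: "nat set \<Rightarrow> nat \<Rightarrow> bitstring" where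
  "restr A n = map (\<lambda>i. i \<in> A) [0..<n]"

text \<open>
  The machine \<open>U\<close> comes with a program \<open>u\<close> for it, which determines the running times.
  The condition \<open>K\<^sup>t(x) - K(x) \<ge> c\<close> is written additively; \<open>K U x\<close> is finite for optimal \<open>U\<close>,
  and the condition holds if no description of \<open>x\<close> is fast enough, that is \<open>K\<^sup>t(x) = \<infinity>\<close>.
\<close>

definition deep :: "(bitstring \<rightharpoonup> bitstring) \<Rightarrow> prog \<Rightarrow> nat set \<Rightarrow> bool" where
  "deep U u X \<longleftrightarrow> (\<forall>t. computable t \<longrightarrow> (\<forall>c::nat.
    \<forall>\<^sub>F n in sequentially. K_time u t (restr X n) \<ge> K U (restr X n) + enat c))"

definition meets :: "nat set \<Rightarrow> bitstring set \<Rightarrow> bool" where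
  "meets A S \<longleftrightarrow> (\<exists>n. restr A n \<in> S)"

definition avoids :: "nat set \<Rightarrow> bitstring set \<Rightarrow> bool" where
  "avoids A S \<longleftrightarrow> (\<exists>n. \<forall>\<tau>. prefix (restr A n) \<tau> \<longrightarrow> \<tau> \<notin> S)"

definition one_generic :: "nat set \<Rightarrow> bool" where
  "one_generic A \<longleftrightarrow> (\<forall>S. ce_set S \<longrightarrow> meets A S \<or> avoids A S)"

end

theory Submission
  imports Defs "HOL-Library.Countable_Set"
begin

text \<open>
  If a finite string is produced within \<open>T\<close> steps only by programs of small total weight, then all its
  extensions \<open>y\<close> are deep for time bounds below \<open>T\<close>: the fast programs for them can be recoded by
  shorter ones. As there are \<open>2 ^ (2 * j)\<close> strings of length \<open>2 * j\<close>, one of them has weight at most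
  \<open>2 ^ - (2 * j)\<close> when it is placed at a given position, and for computable \<open>T\<close> it can be computed.
  A sequence that has such light blocks at regular positions, each of them in charge of the lengths
  up to the end of the next one, satisfies the depth requirement for a single time bound, whatever its
  remaining bits are.

  The set \<open>A\<close> is a limit of finite extensions. At stage \<open>e\<close> the strings with light blocks for the
  \<open>e\<close>-th time bound form a computable tree without dead ends, all of whose members are deep. If one of
  them has no extension in the \<open>e\<close>-th computably enumerable set \<open>W\<close>, extend to it. Otherwise, by
  compactness, the length of the first extension in \<open>W\<close> that a search finds is computably bounded on
  each level of the tree. For this larger bound there is a light block too; placing it in a free
  position makes all strings deep on the way to an element of \<open>W\<close>, and further until the light blocks
  for the next time bound take over.
\<close>

subsection \<open>Closure properties of computable functions\<close>

abbreviation pr :: "nat \<Rightarrow> nat \<Rightarrow> nat" where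
  "pr a b \<equiv> prod_encode (a, b)"

definition p1 :: "nat \<Rightarrow> nat" where
  "p1 x = fst (prod_decode x)"

definition p2 :: "nat \<Rightarrow> nat" where
  "p2 x = snd (prod_decode x)"

lemma p1_pr [simp]: "p1 (pr a b) = a"
  by (simp add: p1_def)

lemma p2_pr [simp]: "p2 (pr a b) = b"
  by (simp add: p2_def)

lemma pr_p1_p2 [simp]: "pr (p1 x) (p2 x) = x"
  by (simp add: p1_def p2_def)

lemma runs_First: "runs First x 1 (p1 x)"
  by (metis runs.first pr_p1_p2)

lemma runs_Second: "runs Second x 1 (p2 x)"
  by (metis runs.second pr_p1_p2)

text \<open>The rules collected here are mostly stated for terms with inner functions such as
  \<open>f x\<close>, so that \<open>intro\<close> follows the syntax of a term down to its
  argument.\<close>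

named_theorems computable_intros

lemma computable_id [computable_intros]: "computable (\<lambda>x. x)"
proof -
  \<comment> \<open>Every number is a pair, so splitting and pairing again is the identity.\<close>
  have "\<exists>s. runs (Tuple First Second) n s n" for n
    by (metis runs.tuple runs_First runs_Second pr_p1_p2)
  then show ?thesis unfolding computable_def by blast
qed

lemma computable_compose:
  assumes "computable F" "computable f"
  shows "computable (\<lambda>x. F (f x))"
proof -
  obtain p q where "\<And>n. \<exists>s. runs p n s (F n)" "\<And>n. \<exists>s. runs q n s (f n)"
    using assms unfolding computable_def by blast
  then have "\<exists>s. runs (Comp p q) n s (F (f n))" for n
    by (meson runs.comp)
  then show ?thesis unfolding computable_def by blast
qed

lemma computable_Suc [computable_intros]:
  "computable f \<Longrightarrow> computable (\<lambda>x. Suc (f x))"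
  by (rule computable_compose[of Suc]) (auto simp: computable_def intro: runs.succ)

lemma computable_p1 [computable_intros]:
  "computable f \<Longrightarrow> computable (\<lambda>x. p1 (f x))"
  by (rule computable_compose[of p1]) (auto simp: computable_def intro: runs_First)

lemma computable_p2 [computable_intros]:
  "computable f \<Longrightarrow> computable (\<lambda>x. p2 (f x))"
  by (rule computable_compose[of p2]) (auto simp: computable_def intro: runs_Second)

lemma computable_const [computable_intros]: "computable (\<lambda>x. c)"
proof (induction c)
  case 0
  then show ?case by (auto simp: computable_def intro: runs.zero)
qed (rule computable_Suc)

lemma computable_pr [computable_intros]:
  assumes "computable f" "computable g"
  shows "computable (\<lambda>x. pr (f x) (g x))"
proof -
  obtain p q where "\<And>n. \<exists>s. runs p n s (f n)" "\<And>n. \<exists>s. runs q n s (g n)"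
    using assms unfolding computable_def by blast
  then have "\<exists>s. runs (Tuple p q) n s (pr (f n) (g n))" for n
    by (meson runs.tuple)
  then show ?thesis unfolding computable_def by blast
qed

lemma computable_compose2:
  assumes "computable (\<lambda>z. F (p1 z) (p2 z))" "computable f" "computable g"
  shows "computable (\<lambda>x. F (f x) (g x))"
  using computable_compose[OF assms(1) computable_pr[OF assms(2,3)]] by simp

text \<open>The parameter of \<open>Prec\<close> is the whole argument \<open>x\<close>, so base and
  step may both depend on it; the recursion depth \<open>b x\<close> is supplied by pairing.\<close>

lemma computable_rec [computable_intros]:
  assumes "computable b" "computable f"
    "computable (\<lambda>z. g (p1 z) (p1 (p2 z)) (p2 (p2 z)))"
  shows "computable (\<lambda>x. rec_nat (f x) (\<lambda>n r. g x n r) (b x))"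
proof -
  obtain p q where p: "\<And>x. \<exists>s. runs p x s (f x)"
    and q: "\<And>z. \<exists>s. runs q z s (g (p1 z) (p1 (p2 z)) (p2 (p2 z)))"
    using assms unfolding computable_def by blast
  have "\<exists>s. runs (Prec p q) (pr a n) s (rec_nat (f a) (g a) n)" for a n
  proof (induction n)
    case 0
    then show ?case using p[of a] by (auto intro: runs.prec_0)
  next
    case (Suc n)
    then obtain s where s: "runs (Prec p q) (pr a n) s (rec_nat (f a) (g a) n)" by blast
    obtain s' where "runs q (pr a (pr n (rec_nat (f a) (g a) n))) s' (rec_nat (f a) (g a) (Suc n))"
      using q[of "pr a (pr n (rec_nat (f a) (g a) n))"] by auto
    then show ?case using s runs.prec_Suc by blast
  qed
  then have "\<exists>s. runs (Prec p q) n s (rec_nat (f (p1 n)) (g (p1 n)) (p2 n))" for n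
    by (metis pr_p1_p2)
  then have "computable (\<lambda>z. rec_nat (f (p1 z)) (g (p1 z)) (p2 z))"
    unfolding computable_def by blast
  from computable_compose2[OF this computable_id assms(1)] show ?thesis .
qed

text \<open>Truth is represented by \<open>0\<close>, the value that \<^const>\<open>Search\<close> looks for.\<close>

definition dec :: "(nat \<Rightarrow> bool) \<Rightarrow> bool" where
  "dec P \<longleftrightarrow> computable (\<lambda>x. if P x then 0 else 1)"

text \<open>Induction on the distance \<open>n\<close> to the first zero, with the starting point
  \<open>m\<close> moving up as in \<open>search_next\<close>.\<close>

lemma runs_Search:
  assumes "\<And>k. k < n \<Longrightarrow> \<exists>s v. runs p (pr a (m + k)) s (Suc v)"
    and "\<exists>s. runs p (pr a (m + n)) s 0"
  shows "\<exists>s. runs (Search p) (pr a m) s (m + n)"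
  using assms
proof (induction n arbitrary: m)
  case 0
  then show ?case using runs.search_stop by fastforce
next
  case (Suc n)
  have "\<exists>s. runs (Search p) (pr a (Suc m)) s (Suc m + n)"
  proof (rule Suc.IH)
    show "\<exists>s v. runs p (pr a (Suc m + k)) s (Suc v)" if "k < n" for k
      using Suc.prems(1)[of "Suc k"] that by simp
  qed (use Suc.prems(2) in simp)
  then show ?case
    using Suc.prems(1)[of 0] by simp (meson runs.search_next)
qed

lemma computable_LEAST [computable_intros]:
  assumes "dec (\<lambda>z. P (p1 z) (p2 z))" "\<And>x. \<exists>n. P x n"
  shows "computable (\<lambda>x. LEAST n. P x n)"
proof -
  obtain p where p: "\<And>x. \<exists>s. runs p x s (if P (p1 x) (p2 x) then 0 else 1)"
    using assms(1) unfolding dec_def computable_def by blast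
  obtain z where z: "\<And>x. \<exists>s. runs z x s (pr x 0)"
    using computable_pr[OF computable_id computable_const] unfolding computable_def by blast
  have "\<exists>s. runs (Search p) (pr x 0) s (0 + (LEAST n. P x n))" for x
  proof (rule runs_Search)
    show "\<exists>s v. runs p (pr x (0 + k)) s (Suc v)" if "k < (LEAST n. P x n)" for k
      using p[of "pr x k"] not_less_Least[OF that] by auto
    show "\<exists>s. runs p (pr x (0 + (LEAST n. P x n))) s 0"
      using p[of "pr x (LEAST n. P x n)"] LeastI_ex[OF assms(2)] by simp
  qed
  then have "\<exists>s. runs (Comp (Search p) z) x s (LEAST n. P x n)" for x
    using z[of x] by simp (meson runs.comp)
  then show ?thesis unfolding computable_def by blast
qed

lemma computable_if [computable_intros]:
  assumes "dec P" "computable f" "computable g"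
  shows "computable (\<lambda>x. if P x then f x else g x)"
proof -
  \<comment> \<open>Recursion over the truth value, which is \<open>0\<close> or \<open>1\<close>,
    selects the branch.\<close>
  have "computable (\<lambda>x. rec_nat (f x) (\<lambda>n r. g x) (if P x then 0 else 1))"
    using assms unfolding dec_def
    by (intro computable_rec computable_compose[OF assms(3)] computable_intros)
  moreover have "rec_nat (f x) (\<lambda>n r. g x) (if P x then 0 else 1) = (if P x then f x else g x)" for x
    by simp
  ultimately show ?thesis by simp
qed

lemma dec_not [computable_intros]:
  assumes "dec P" shows "dec (\<lambda>x. \<not> P x)"
  using computable_if[OF assms computable_const[of 1] computable_const[of 0]]
  unfolding dec_def by (rule back_subst[where P=computable]) auto

lemma dec_const [computable_intros]: "dec (\<lambda>x. c)"
  unfolding dec_def by (intro computable_intros)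

lemma dec_if:
  assumes "dec P" "dec Q" "dec R" shows "dec (\<lambda>x. if P x then Q x else R x)"
proof -
  have "computable (\<lambda>x. if P x then if Q x then 0 else 1 else if R x then 0 else (1::nat))"
    using assms(2,3) unfolding dec_def by (rule computable_if[OF assms(1)])
  then show ?thesis unfolding dec_def by (rule back_subst[where P=computable]) auto
qed

lemma dec_conj [computable_intros]:
  assumes "dec P" "dec Q" shows "dec (\<lambda>x. P x \<and> Q x)"
  using dec_if[OF assms dec_const[of False]] by (rule back_subst[where P=dec]) auto

lemma dec_disj [computable_intros]:
  assumes "dec P" "dec Q" shows "dec (\<lambda>x. P x \<or> Q x)"
  using dec_if[OF assms(1) dec_const[of True] assms(2)] by (rule back_subst[where P=dec]) auto

lemma dec_imp [computable_intros]:
  assumes "dec P" "dec Q" shows "dec (\<lambda>x. P x \<longrightarrow> Q x)"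
  using dec_if[OF assms dec_const[of True]] by (rule back_subst[where P=dec]) auto

lemma dec_iff [computable_intros]:
  assumes "dec P" "dec Q" shows "dec (\<lambda>x. P x \<longleftrightarrow> Q x)"
  using dec_if[OF assms dec_not[OF assms(2)]] by (rule back_subst[where P=dec]) auto

lemma dec_eq_0: "computable f \<Longrightarrow> dec (\<lambda>x. f x = 0)"
proof -
  assume "computable f"
  then have "computable (\<lambda>x. rec_nat 0 (\<lambda>n r. 1) (f x))"
    by (intro computable_intros)
  moreover have "rec_nat 0 (\<lambda>n r. 1) k = (if k = 0 then 0 else 1 :: nat)" for k :: nat
    by (cases k) auto
  ultimately show ?thesis by (simp only: dec_def)
qed

lemma computable_add [computable_intros]:
  assumes "computable f" "computable g"
  shows "computable (\<lambda>x. f x + g x)"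
proof -
  have "computable (\<lambda>x. rec_nat (f x) (\<lambda>n r. Suc r) (g x))"
    using assms by (intro computable_intros)
  moreover have "rec_nat a (\<lambda>n r. Suc r) b = a + b" for a b :: nat
    by (induction b) auto
  ultimately show ?thesis by simp
qed

lemma computable_mult [computable_intros]:
  assumes "computable f" "computable g"
  shows "computable (\<lambda>x. f x * g x)"
proof -
  have "computable (\<lambda>x. rec_nat 0 (\<lambda>n r. r + f x) (g x))"
    using assms by (intro computable_intros computable_compose[OF assms(1)])
  moreover have "rec_nat 0 (\<lambda>n r. r + a) b = a * b" for a b :: nat
    by (induction b) auto
  ultimately show ?thesis by simp
qed

lemma computable_power [computable_intros]:
  assumes "computable f" "computable g"
  shows "computable (\<lambda>x. f x ^ g x)"
proof -
  have "computable (\<lambda>x. rec_nat 1 (\<lambda>n r. r * f x) (g x))"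
    using assms by (intro computable_intros computable_compose[OF assms(1)])
  moreover have "rec_nat 1 (\<lambda>n r. r * a) b = a ^ b" for a b :: nat
    by (induction b) auto
  ultimately show ?thesis by simp
qed

lemma computable_diff [computable_intros]:
  assumes "computable f" "computable g"
  shows "computable (\<lambda>x. f x - g x)"
proof -
  have pred: "computable (\<lambda>z. rec_nat 0 (\<lambda>n r. n) (z))"
    by (intro computable_intros)
  have "computable (\<lambda>x. rec_nat (f x) (\<lambda>n r. rec_nat 0 (\<lambda>n r. n) r) (g x))"
    using assms by (intro computable_intros computable_compose[OF pred])
  moreover have "rec_nat a (\<lambda>n r. rec_nat 0 (\<lambda>n r. n) r) b = a - b" for a b :: nat
  proof (induction b)
    case (Suc b)
    have "rec_nat 0 (\<lambda>n r. n) k = k - 1" for k :: nat by (cases k) auto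
    then show ?case using Suc by simp
  qed simp
  ultimately show ?thesis by simp
qed

lemma dec_le [computable_intros]:
  assumes "computable f" "computable g"
  shows "dec (\<lambda>x. f x \<le> g x)"
  using dec_eq_0[OF computable_diff[OF assms]] by simp

lemma dec_less [computable_intros]:
  assumes "computable f" "computable g"
  shows "dec (\<lambda>x. f x < g x)"
  using dec_not[OF dec_le[OF assms(2,1)]] by (simp add: not_le)

lemma dec_eq [computable_intros]:
  assumes "computable f" "computable g"
  shows "dec (\<lambda>x. f x = g x)"
  using dec_conj[OF dec_le[OF assms] dec_le[OF assms(2,1)]] by (simp add: eq_iff)


lemma dec_compose:
  "dec P \<Longrightarrow> computable f \<Longrightarrow> dec (\<lambda>x. P (f x))"
  unfolding dec_def by (rule computable_compose)

text \<open>The search stops at the first counterexample below \<open>b x\<close>, or at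
  \<open>b x\<close> itself, where the implication is vacuous. Comparing the result with
  \<open>b x\<close> decides the quantifier.\<close>

lemma dec_bounded_All [computable_intros]:
  assumes "dec (\<lambda>z. P (p1 z) (p2 z))" "computable b"
  shows "dec (\<lambda>x. \<forall>i<b x. P x i)"
proof -
  have "computable (\<lambda>x. LEAST i. i < b x \<longrightarrow> \<not> P x i)"
    using assms by (intro computable_intros computable_compose[OF assms(2)]) auto
  from dec_le[OF assms(2) this]
  have "dec (\<lambda>x. b x \<le> (LEAST i. i < b x \<longrightarrow> \<not> P x i))" .
  moreover have "b x \<le> (LEAST i. i < b x \<longrightarrow> \<not> P x i) \<longleftrightarrow> (\<forall>i<b x. P x i)" for x
  proof
    assume "b x \<le> (LEAST i. i < b x \<longrightarrow> \<not> P x i)"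
    then show "\<forall>i<b x. P x i" using not_less_Least less_le_trans by blast
  next
    assume all: "\<forall>i<b x. P x i"
    have "\<exists>i. i < b x \<longrightarrow> \<not> P x i" by auto
    from LeastI_ex[OF this] all show "b x \<le> (LEAST i. i < b x \<longrightarrow> \<not> P x i)" by force
  qed
  ultimately show ?thesis by simp
qed

lemma dec_bounded_Ex [computable_intros]:
  assumes "dec (\<lambda>z. P (p1 z) (p2 z))" "computable b"
  shows "dec (\<lambda>x. \<exists>i<b x. P x i)"
  using dec_not[OF dec_bounded_All[OF dec_not[OF assms(1)] assms(2)]] by simp

lemma computable_sum_lessThan [computable_intros]:
  assumes "computable (\<lambda>z. f (p1 z) (p2 z))" "computable b"
  shows "computable (\<lambda>x. \<Sum>i<b x. f x i)"
proof -
  have "computable (\<lambda>x. rec_nat 0 (\<lambda>n r. r + f x n) (b x))"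
    using assms(2) by (intro computable_intros computable_compose2[OF assms(1)])
  moreover have "rec_nat 0 (\<lambda>n r. r + f x n) k = (\<Sum>i<k. f x i)" for x k
    by (induction k) auto
  ultimately show ?thesis by simp
qed

subsection \<open>Binary strings and bounded evaluation\<close>

definition S :: "nat \<Rightarrow> bitstring" where
  "S = inv str_code"

lemma S_str_code [simp]: "S (str_code \<sigma>) = \<sigma>"
  by (simp add: S_def bij_is_inj[OF bij_str_code])

lemma str_code_S [simp]: "str_code (S x) = x"
  by (simp add: S_def surj_f_inv_f[OF bij_is_surj[OF bij_str_code]])

lemma str_code_eq_iff [simp]: "str_code \<sigma> = str_code \<tau> \<longleftrightarrow> \<sigma> = \<tau>"
  using S_str_code by metis

lemma str_code_eq_0_iff: "str_code \<sigma> = 0 \<longleftrightarrow> \<sigma> = []"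
  by (cases \<sigma>) auto

lemma str_code_bounds: "2 ^ length \<sigma> \<le> Suc (str_code \<sigma>)" "Suc (str_code \<sigma>) < 2 ^ Suc (length \<sigma>)"
  by (induction \<sigma>) auto

lemma length_le_str_code: "length \<sigma> \<le> str_code \<sigma>"
  by (induction \<sigma>) auto

text \<open>Bits beyond the end are \<open>False\<close>, whereas \<open>nth\<close> is unspecified
  there. Relations between strings thus become bounded conditions on decidable bits.\<close>

definition nthb :: "bitstring \<Rightarrow> nat \<Rightarrow> bool" where
  "nthb \<sigma> i \<longleftrightarrow> i < length \<sigma> \<and> \<sigma> ! i"

lemma nthb_eq_nth: "i < length \<sigma> \<Longrightarrow> nthb \<sigma> i \<longleftrightarrow> \<sigma> ! i"
  by (simp add: nthb_def)

lemma nthb_append: "nthb (\<sigma> @ \<tau>) i = (if i < length \<sigma> then nthb \<sigma> i else nthb \<tau> (i - length \<sigma>))"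
  by (auto simp: nthb_def nth_append)

lemma bitstring_eqI:
  assumes "length \<sigma> = length \<tau>" "\<And>i. i < length \<sigma> \<Longrightarrow> nthb \<sigma> i = nthb \<tau> i"
  shows "\<sigma> = \<tau>"
  using assms by (auto simp: nthb_def intro: nth_equalityI)

lemma prefix_iff_nthb:
  "prefix \<sigma> \<tau> \<longleftrightarrow> length \<sigma> \<le> length \<tau> \<and> (\<forall>i<length \<sigma>. nthb \<sigma> i = nthb \<tau> i)"
proof
  assume "prefix \<sigma> \<tau>"
  then show "length \<sigma> \<le> length \<tau> \<and> (\<forall>i<length \<sigma>. nthb \<sigma> i = nthb \<tau> i)"
    by (auto simp: prefix_def nthb_append)
next
  assume *: "length \<sigma> \<le> length \<tau> \<and> (\<forall>i<length \<sigma>. nthb \<sigma> i = nthb \<tau> i)"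
  then have "take (length \<sigma>) \<tau> = \<sigma>"
    by (intro bitstring_eqI) (auto simp: nthb_def)
  then show "prefix \<sigma> \<tau>" by (metis take_is_prefix)
qed

lemma computable_str_code_S [computable_intros]:
  "computable f \<Longrightarrow> computable (\<lambda>x. str_code (S (f x)))"
  by simp

text \<open>The code of \<open>b # \<sigma>\<close> is \<open>2 * k + 1\<close> or
  \<open>2 * k + 2\<close> for the code \<open>k\<close> of \<open>\<sigma>\<close>; the code
  \<open>0\<close> is sent to \<open>0\<close>, in accordance with
  \<open>tl [] = []\<close>.\<close>

lemma computable_tail_code:
  obtains t where "computable t" "\<And>\<sigma>. t (str_code \<sigma>) = str_code (tl \<sigma>)"
proof
  show "computable (\<lambda>x. LEAST k. x \<le> 2 * k + 2)"
    by (intro computable_intros) presburger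
  show "(LEAST k. str_code \<sigma> \<le> 2 * k + 2) = str_code (tl \<sigma>)" for \<sigma>
    by (cases \<sigma>) (auto intro!: Least_equality)
qed

lemma computable_drop_code:
  obtains d where "computable (\<lambda>z. d (p1 z) (p2 z))"
    "\<And>\<sigma> i. d (str_code \<sigma>) i = str_code (drop i \<sigma>)"
proof -
  obtain t where t: "computable t" "\<And>\<sigma>. t (str_code \<sigma>) = str_code (tl \<sigma>)"
    by (rule computable_tail_code) blast
  have "computable (\<lambda>z. rec_nat (p1 z) (\<lambda>n r. t r) (p2 z))"
    by (intro computable_intros computable_compose[OF t(1)])
  moreover have "rec_nat (str_code \<sigma>) (\<lambda>n r. t r) i = str_code (drop i \<sigma>)" for \<sigma> i
    by (induction i) (auto simp: t drop_Suc tl_drop)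
  ultimately show thesis by (intro that[of "\<lambda>x i. rec_nat x (\<lambda>n r. t r) i"])
qed

lemma computable_length [computable_intros]:
  assumes "computable (\<lambda>x. str_code (F x))"
  shows "computable (\<lambda>x. length (F x))"
proof -
  obtain d where d: "computable (\<lambda>z. d (p1 z) (p2 z))"
    "\<And>\<sigma> i. d (str_code \<sigma>) i = str_code (drop i \<sigma>)"
    by (rule computable_drop_code) blast
  have "computable (\<lambda>x. LEAST i. d (str_code (F x)) i = 0)"
  proof (intro computable_intros)
    show "computable (\<lambda>z. d (str_code (F (p1 z))) (p2 z))"
      by (rule computable_compose2[OF d(1)])
        (intro computable_intros computable_compose[OF assms])+
    show "\<exists>i. d (str_code (F x)) i = 0" for x
      by (auto simp: d str_code_eq_0_iff)
  qed
  moreover have "(LEAST i. d (str_code (F x)) i = 0) = length (F x)" for x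
    by (rule Least_equality) (auto simp: d str_code_eq_0_iff)
  ultimately show ?thesis by simp
qed

text \<open>The bit at \<open>i\<close> is the head of \<open>drop i\<close>, and a string begins
  with \<open>True\<close> iff its code is positive and even.\<close>

lemma dec_nthb [computable_intros]:
  assumes "computable (\<lambda>x. str_code (F x))" "computable g"
  shows "dec (\<lambda>x. nthb (F x) (g x))"
proof -
  obtain d where d: "computable (\<lambda>z. d (p1 z) (p2 z))"
    "\<And>\<sigma> i. d (str_code \<sigma>) i = str_code (drop i \<sigma>)"
    by (rule computable_drop_code) blast
  have *: "dec (\<lambda>x. \<exists>k<x. x = 2 * k + 2)"
    by (intro computable_intros)
  have "dec (\<lambda>x. \<exists>k<d (str_code (F x)) (g x). d (str_code (F x)) (g x) = 2 * k + 2)"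
    by (rule dec_compose[OF *]) (rule computable_compose2[OF d(1) assms])
  moreover have "(\<exists>k<str_code \<sigma>. str_code \<sigma> = 2 * k + 2) \<longleftrightarrow> nthb \<sigma> 0" for \<sigma>
    by (cases \<sigma>) (auto simp: nthb_def, presburger+)
  then have "(\<exists>k<d (str_code (F x)) (g x). d (str_code (F x)) (g x) = 2 * k + 2)
      \<longleftrightarrow> nthb (F x) (g x)" for x
    by (auto simp: d nthb_def)
  ultimately show ?thesis by simp
qed

lemma dec_prefix [computable_intros]:
  assumes "computable (\<lambda>x. str_code (F x))" "computable (\<lambda>x. str_code (G x))"
  shows "dec (\<lambda>x. prefix (F x) (G x))"
  unfolding prefix_iff_nthb
  by (intro computable_intros assms computable_compose[OF assms(1)] computable_compose[OF assms(2)])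

text \<open>The machines constructed below have this shape: search for a certificate
  \<open>n\<close>, then compute the output from input and certificate. As \<open>implements\<close>
  also demands divergence outside the domain, a halting run is traced back to a successful
  search.\<close>

lemma partial_computable_search:
  assumes "dec (\<lambda>z. Q (S (p1 z)) (p2 z))" "computable g"
  shows "partial_computable (\<lambda>\<sigma>. if \<exists>n. Q \<sigma> n
    then Some (S (g (pr (str_code \<sigma>) (LEAST n. Q \<sigma> n)))) else None)"
proof -
  obtain q where q: "\<And>x. \<exists>s. runs q x s (if Q (S (p1 x)) (p2 x) then 0 else 1)"
    using assms(1) unfolding dec_def computable_def by blast
  obtain r where r: "\<And>x. \<exists>s. runs r x s (g x)"
    using assms(2) unfolding computable_def by blast
  obtain z where z: "\<And>x. \<exists>s. runs z x s (pr x 0)"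
    using computable_pr[OF computable_id computable_const] unfolding computable_def by blast
  obtain i where i: "\<And>x. \<exists>s. runs i x s x"
    using computable_id unfolding computable_def by blast
  define p where "p = Comp r (Tuple i (Comp (Search q) z))"
  have search: "\<exists>s. runs (Search q) (pr (str_code \<sigma>) 0) s (0 + (LEAST n. Q \<sigma> n))"
    if "\<exists>n. Q \<sigma> n" for \<sigma>
  proof (rule runs_Search)
    show "\<exists>s v. runs q (pr (str_code \<sigma>) (0 + k)) s (Suc v)" if "k < (LEAST n. Q \<sigma> n)" for k
      using q[of "pr (str_code \<sigma>) k"] not_less_Least[OF that] by auto
    show "\<exists>s. runs q (pr (str_code \<sigma>) (0 + (LEAST n. Q \<sigma> n))) s 0"
      using q[of "pr (str_code \<sigma>) (LEAST n. Q \<sigma> n)"] LeastI_ex[OF that] by simp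
  qed
  have ex: "\<exists>s. runs p (str_code \<sigma>) s (g (pr (str_code \<sigma>) (LEAST n. Q \<sigma> n)))"
    if "\<exists>n. Q \<sigma> n" for \<sigma>
    using search[OF that] z[of "str_code \<sigma>"] i[of "str_code \<sigma>"]
      r[of "pr (str_code \<sigma>) (LEAST n. Q \<sigma> n)"]
    unfolding p_def by simp (meson runs.comp runs.tuple)
  have zero: "Q (S (p1 x)) (p2 x)" if "runs q x s 0" for x s
    using q[of x] runs_deterministic[OF that] by (auto split: if_splits)
  \<comment> \<open>The equation \<open>f = Search q\<close> keeps the program a variable for the
    rule induction.\<close>
  have search_conv: "Q (S (p1 x)) n" if "runs f x s n" "f = Search q" for f x s n
    using that
  proof (induction rule: runs.induct)
    case (search_stop p a m s)
    then show ?case using zero[of "pr a m"] by simp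
  next
    case (search_next p a m s v s' n)
    then show ?case by simp
  qed auto
  have conv: "\<exists>n. Q \<sigma> n" if p: "runs p (str_code \<sigma>) s y" for \<sigma> s y
  proof -
    from p obtain s' w where "runs (Tuple i (Comp (Search q) z)) (str_code \<sigma>) s' w"
      unfolding p_def by (auto elim: runs.cases)
    then obtain s'' w' where "runs (Comp (Search q) z) (str_code \<sigma>) s'' w'"
      by (auto elim: runs.cases)
    then obtain s1 s2 v where *: "runs z (str_code \<sigma>) s1 v" "runs (Search q) v s2 w'"
      by (auto elim: runs.cases)
    then have "v = pr (str_code \<sigma>) 0" using z[of "str_code \<sigma>"] runs_deterministic by blast
    then show ?thesis using search_conv[OF *(2)] by auto
  qed
  have "implements p (\<lambda>\<sigma>. if \<exists>n. Q \<sigma> n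
    then Some (S (g (pr (str_code \<sigma>) (LEAST n. Q \<sigma> n)))) else None)"
    unfolding implements_def
  proof (intro allI)
    fix \<sigma> x
    show "(if \<exists>n. Q \<sigma> n then Some (S (g (pr (str_code \<sigma>) (LEAST n. Q \<sigma> n)))) else None) = Some x
      \<longleftrightarrow> (\<exists>s. runs p (str_code \<sigma>) s (str_code x))"
    proof (cases "\<exists>n. Q \<sigma> n")
      case True
      then show ?thesis
        using ex[OF True] runs_deterministic by simp (metis S_str_code str_code_S)
    next
      case False
      then show ?thesis using conv[of \<sigma>] by auto
    qed
  qed
  then show ?thesis unfolding partial_computable_def by blast
qed

text \<open>Bounding the number of iterations of every search makes evaluation total, hence computable.
  The value \<open>0\<close> means that the bound was exceeded, and \<open>Suc y\<close> that the result is \<open>y\<close>.\<close>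

primrec bounded_eval :: "prog \<Rightarrow> nat \<Rightarrow> nat \<Rightarrow> nat" where
  "bounded_eval Zero s x = 1"
| "bounded_eval Succ s x = Suc (Suc x)"
| "bounded_eval First s x = Suc (p1 x)"
| "bounded_eval Second s x = Suc (p2 x)"
| "bounded_eval (Tuple p q) s x =
    (if bounded_eval p s x = 0 \<or> bounded_eval q s x = 0 then 0
     else Suc (pr (bounded_eval p s x - 1) (bounded_eval q s x - 1)))"
| "bounded_eval (Comp p q) s x =
    (if bounded_eval q s x = 0 then 0 else bounded_eval p s (bounded_eval q s x - 1))"
| "bounded_eval (Prec p q) s x =
    rec_nat (bounded_eval p s (p1 x))
      (\<lambda>n r. if r = 0 then 0 else bounded_eval q s (pr (p1 x) (pr n (r - 1)))) (p2 x)"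
| "bounded_eval (Search p) s x =
    (let k = (LEAST k. s \<le> k \<or> bounded_eval p s (pr (p1 x) (p2 x + k)) = 1
        \<and> (\<forall>i<k. 1 < bounded_eval p s (pr (p1 x) (p2 x + i))))
     in if k < s then Suc (p2 x + k) else 0)"

text \<open>The program is a fixed parameter, so induction on its structure suffices. In the
  \<open>Search\<close> clause the alternative \<open>s \<le> k\<close> makes the least number
  exist, as \<open>computable_LEAST\<close> demands.\<close>

lemma computable_bounded_eval:
  "computable f \<Longrightarrow> computable g \<Longrightarrow> computable (\<lambda>x. bounded_eval p (f x) (g x))"
proof (induction p arbitrary: f g)
  case (Comp p q)
  show ?case unfolding bounded_eval.simps
    by (intro computable_intros Comp)
next
  case (Prec p q)
  show ?case unfolding bounded_eval.simps
    by (intro computable_intros Prec computable_compose[OF Prec.prems(1)]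
        computable_compose[OF Prec.prems(2)])
next
  case (Search p)
  show ?case unfolding bounded_eval.simps Let_def
    by (intro computable_intros Search computable_compose[OF Search.prems(1)]
        computable_compose[OF Search.prems(2)]) auto
qed (unfold bounded_eval.simps, (intro computable_intros; assumption?)+)

text \<open>The bound \<open>s\<close> limits the iterations of searches, not the steps, so only the
  existence of a run is claimed.\<close>

lemma bounded_eval_sound: "bounded_eval p s x = Suc y \<Longrightarrow> \<exists>s'. runs p x s' y"
proof (induction p arbitrary: x y)
  case Zero
  then show ?case by (auto intro: runs.zero)
next
  case Succ
  then show ?case by (auto intro: runs.succ)
next
  case First
  then show ?case by (auto intro: runs_First)
next
  case Second
  then show ?case by (auto intro: runs_Second)
next
  case (Tuple p q)
  from Tuple.prems obtain a b where "bounded_eval p s x = Suc a" "bounded_eval q s x = Suc b"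
    by (auto split: if_splits simp: gr0_conv_Suc)
  with Tuple show ?case by (auto dest!: Tuple.IH intro: runs.tuple)
next
  case (Comp p q)
  from Comp.prems obtain a where "bounded_eval q s x = Suc a"
    by (auto split: if_splits simp: gr0_conv_Suc)
  with Comp show ?case by (auto dest!: Comp.IH intro: runs.comp)
next
  case (Prec p q)
  define F where "F = rec_nat (bounded_eval p s (p1 x))
      (\<lambda>n r. if r = 0 then 0 else bounded_eval q s (pr (p1 x) (pr n (r - 1))))"
  have "\<exists>s'. runs (Prec p q) (pr (p1 x) n) s' y" if "F n = Suc y" for n y
    using that
  proof (induction n arbitrary: y)
    case 0
    then have "bounded_eval p s (p1 x) = Suc y" by (simp add: F_def)
    then show ?case using Prec.IH(1) runs.prec_0 by blast
  next
    case (Suc n)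
    from Suc.prems obtain r where r: "F n = Suc r"
      by (cases "F n") (auto simp: F_def)
    with Suc.prems have "bounded_eval q s (pr (p1 x) (pr n r)) = Suc y" by (simp add: F_def)
    then show ?case using Prec.IH(2) Suc.IH[OF r] runs.prec_Suc by blast
  qed
  from this[of "p2 x" y] show ?case using Prec.prems by (simp add: F_def)
next
  case (Search p)
  let ?P = "\<lambda>k. bounded_eval p s (pr (p1 x) (p2 x + k)) = 1
        \<and> (\<forall>i<k. 1 < bounded_eval p s (pr (p1 x) (p2 x + i)))"
  define k where "k = (LEAST k. s \<le> k \<or> ?P k)"
  have k: "k < s" "y = p2 x + k"
    using Search.prems by (auto simp: Let_def k_def split: if_splits)
  have "s \<le> k \<or> ?P k" unfolding k_def by (rule LeastI[of _ s]) simp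
  with k have P: "?P k" by simp
  have "\<exists>s. runs (Search p) (pr (p1 x) (p2 x)) s (p2 x + k)"
  proof (rule runs_Search)
    show "\<exists>s v. runs p (pr (p1 x) (p2 x + i)) s (Suc v)" if "i < k" for i
    proof -
      have "1 < bounded_eval p s (pr (p1 x) (p2 x + i))" using P that by blast
      then obtain v where "bounded_eval p s (pr (p1 x) (p2 x + i)) = Suc (Suc v)"
        by (metis One_nat_def Suc_lessE less_natE)
      then show ?thesis using Search.IH by blast
    qed
    show "\<exists>s. runs p (pr (p1 x) (p2 x + k)) s 0"
      using P by (intro Search.IH) simp
  qed
  then show ?case using k by simp
qed

text \<open>A search that halts after \<open>s'\<close> steps makes fewer than \<open>s'\<close>
  unsuccessful iterations. The induction carries this as \<open>y < p2 x + s'\<close>, since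
  evaluation fails once \<open>s\<close> iterations are reached.\<close>

lemma bounded_eval_complete:
  "runs p x s' y \<Longrightarrow> s' \<le> s \<Longrightarrow> bounded_eval p s x = Suc y"
proof -
  have "s' \<le> s \<Longrightarrow> bounded_eval p s x = Suc y \<and> (\<forall>q. p = Search q \<longrightarrow> y < p2 x + s')"
    if "runs p x s' y" for s'
    using that
  proof (induction rule: runs.induct)
    case (search_stop p a m s1)
    then have "(LEAST k. s \<le> k \<or> bounded_eval p s (pr a (m + k)) = 1
        \<and> (\<forall>i<k. 1 < bounded_eval p s (pr a (m + i)))) = 0"
      by (intro Least_equality) auto
    then show ?case using search_stop by simp
  next
    case (search_next p a m s1 v s2 n)
    let ?P = "\<lambda>m k. bounded_eval p s (pr a (m + k)) = 1
        \<and> (\<forall>i<k. 1 < bounded_eval p s (pr a (m + i)))"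
    define k where "k = (LEAST k. s \<le> k \<or> ?P (Suc m) k)"
    have n: "bounded_eval (Search p) s (pr a (Suc m)) = Suc n" "n < Suc m + s2"
      and v: "bounded_eval p s (pr a m) = Suc (Suc v)"
      using search_next by auto
    then have k: "k < s" "n = Suc m + k"
      by (auto simp: Let_def k_def split: if_splits)
    have "s \<le> k \<or> ?P (Suc m) k" unfolding k_def by (rule LeastI[of _ s]) simp
    with k have P: "?P (Suc m) k" by simp
    have "Suc k < s" using k n search_next.prems by simp
    have P': "?P m (Suc k)"
      using P v by (auto simp: less_Suc_eq_0_disj)
    have "(LEAST k. s \<le> k \<or> ?P m k) = Suc k"
    proof (rule Least_equality)
      fix j assume j: "s \<le> j \<or> ?P m j"
      show "Suc k \<le> j"
      proof (rule ccontr)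
        assume "\<not> Suc k \<le> j"
        then have "j < Suc k" by simp
        with P' have "1 < bounded_eval p s (pr a (m + j))" by blast
        with j \<open>j < Suc k\<close> \<open>Suc k < s\<close> show False by auto
      qed
    qed (use P' in blast)
    then show ?case using k n \<open>Suc k < s\<close> by simp
  next
    case (prec_Suc p q a n s1 r s2 y)
    then have "bounded_eval (Prec p q) s (pr a n) = Suc r"
      "bounded_eval q s (pr a (pr n r)) = Suc y"
      by auto
    then show ?case unfolding bounded_eval.simps p1_pr p2_pr by simp
  qed auto
  then show "runs p x s' y \<Longrightarrow> s' \<le> s \<Longrightarrow> bounded_eval p s x = Suc y" by blast
qed

subsection \<open>The Kraft inequality and light classes\<close>

lemma card_bitstrings: "card {w :: bitstring. length w = n} = 2 ^ n"
  using card_lists_length_eq[of "UNIV :: bool set" n] by simp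

lemma finite_bitstrings: "finite {w :: bitstring. length w = n}"
  using finite_lists_length_eq[of "UNIV :: bool set" n] by simp

lemma card_extensions:
  assumes "length p \<le> n"
  shows "card {w :: bitstring. length w = n \<and> prefix p w} = 2 ^ (n - length p)"
proof -
  have "{w. length w = n \<and> prefix p w} = (@) p ` {w. length w = n - length p}"
    using assms by (auto simp: prefix_def)
  then show ?thesis by (simp add: card_image inj_on_def card_bitstrings)
qed

text \<open>The extensions of length \<open>N\<close> of distinct members are disjoint sets. Weights
  are scaled by \<open>2 ^ N\<close> to stay within the natural numbers, here and below.\<close>

lemma kraft_inequality:
  assumes "finite F" "prefix_free F" "\<And>p. p \<in> F \<Longrightarrow> length p \<le> N"
  shows "(\<Sum>p\<in>F. 2 ^ (N - length p)) \<le> (2 ^ N :: nat)"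
proof -
  let ?E = "\<lambda>p. {w :: bitstring. length w = N \<and> prefix p w}"
  have "(\<Sum>p\<in>F. 2 ^ (N - length p)) = (\<Sum>p\<in>F. card (?E p))"
    using assms(3) by (intro sum.cong) (auto simp: card_extensions)
  also have "\<dots> = card (\<Union>p\<in>F. ?E p)"
  proof (rule card_UN_disjoint[symmetric])
    show "\<forall>p\<in>F. \<forall>q\<in>F. p \<noteq> q \<longrightarrow> ?E p \<inter> ?E q = {}"
      using assms(2) prefix_same_cases unfolding prefix_free_def strict_prefix_def by blast
  qed (use assms(1) finite_subset[OF _ finite_bitstrings[of N]] in auto)
  also have "\<dots> \<le> card {w :: bitstring. length w = N}"
    by (intro card_mono finite_bitstrings) auto
  finally show ?thesis by (simp add: card_bitstrings)
qed

text \<open>A converse of the Kraft inequality: total weight at most \<open>2 ^ - L\<close> leaves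
  room for codewords that are shorter by \<open>L\<close>. They are chosen greedily;
  \<open>finite_ranking_induct\<close> adds the longest string last, so a new codeword only has to
  avoid extending earlier ones.\<close>

lemma kraft_shortening:
  assumes "finite F" "\<And>p. p \<in> F \<Longrightarrow> length p \<le> N"
    and "2 ^ L * (\<Sum>p\<in>F. 2 ^ (N - length p)) \<le> (2 ^ N :: nat)"
  shows "\<exists>f :: bitstring \<Rightarrow> bitstring. (\<forall>p\<in>F. length (f p) + L = length p) \<and>
    (\<forall>p\<in>F. \<forall>q\<in>F. prefix (f p) (f q) \<longrightarrow> p = q)"
  using assms
proof (induction F rule: finite_ranking_induct[where f = length])
  case empty
  then show ?case by simp
next
  case (insert p F)
  show ?case
  proof (cases "p \<in> F")
    case True
    then show ?thesis using insert by (simp add: insert_absorb)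
  next
    case False
    have sum: "2 ^ L * 2 ^ (N - length p) + 2 ^ L * (\<Sum>q\<in>F. 2 ^ (N - length q)) \<le> (2 ^ N :: nat)"
      using insert.prems(2) insert.hyps False by (simp add: distrib_left)
    have pN: "length p \<le> N" using insert.prems by simp
    obtain f :: "bitstring \<Rightarrow> bitstring" where
      f: "\<And>q. q \<in> F \<Longrightarrow> length (f q) + L = length q"
        "\<And>q r. q \<in> F \<Longrightarrow> r \<in> F \<Longrightarrow> prefix (f q) (f r) \<Longrightarrow> q = r"
      using insert.IH insert.prems sum by force
    have "(2::nat) ^ (L + (N - length p)) \<le> 2 ^ N"
      using sum by (simp add: power_add)
    then have Lp: "L \<le> length p" using pN by (simp add: power_increasing_iff)
    define l where "l = length p - L"
    let ?E = "\<lambda>q. {w :: bitstring. length w = l \<and> prefix (f q) w}"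
    have le: "length (f q) \<le> l" "length q \<le> length p" if "q \<in> F" for q
      using f(1)[OF that] insert.hyps that unfolding l_def by fastforce+
    have "card (\<Union>q\<in>F. ?E q) \<le> (\<Sum>q\<in>F. card (?E q))"
      using insert.hyps by (intro card_UN_le) auto
    also have "\<dots> = (\<Sum>q\<in>F. 2 ^ (length p - length q))"
    proof (rule sum.cong)
      fix q assume q: "q \<in> F"
      have "l - length (f q) = length p - length q"
        using f(1)[OF q] unfolding l_def by simp
      then show "card (?E q) = 2 ^ (length p - length q)"
        using le[OF q] by (simp add: card_extensions)
    qed simp
    also have "\<dots> < 2 ^ l"
    proof -
      \<comment> \<open>The count is compared after rescaling from length \<open>l\<close> to
        \<open>N\<close>. It is strict because the term of the new \<open>p\<close> in
        \<open>sum\<close> is positive.\<close>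
      have "2 ^ (L + (N - length p)) * (\<Sum>q\<in>F. 2 ^ (length p - length q))
          = 2 ^ L * (\<Sum>q\<in>F. 2 ^ (N - length q) :: nat)"
        unfolding sum_distrib_left
      proof (rule sum.cong)
        fix q assume q: "q \<in> F"
        have "L + (N - length p) + (length p - length q) = L + (N - length q)"
          using le[OF q] pN by simp
        then show "2 ^ (L + (N - length p)) * 2 ^ (length p - length q)
            = (2 ^ L * 2 ^ (N - length q) :: nat)"
          by (simp only: power_add[symmetric])
      qed simp
      also have "\<dots> < 2 ^ N"
        using sum by (rule less_le_trans[rotated]) simp
      also have "(2::nat) ^ N = 2 ^ (L + (N - length p)) * 2 ^ l"
        using Lp pN by (simp add: l_def power_add[symmetric])
      finally show ?thesis by (metis nat_mult_less_cancel_disj)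
    qed
    also have "\<dots> = card {w :: bitstring. length w = l}" by (simp add: card_bitstrings)
    finally have less: "card (\<Union>q\<in>F. ?E q) < card {w :: bitstring. length w = l}" .
    have "finite (\<Union>q\<in>F. ?E q)"
      by (rule finite_subset[OF _ finite_bitstrings[of l]]) auto
    then have "\<not> {w. length w = l} \<subseteq> (\<Union>q\<in>F. ?E q)"
      using card_mono less by (auto simp: not_le[symmetric])
    then obtain w where w: "length w = l" "\<And>q. q \<in> F \<Longrightarrow> \<not> prefix (f q) w"
      by blast
    \<comment> \<open>Earlier codewords are at most as long as \<open>w\<close>, so \<open>w\<close>
      could be a prefix of one only by being equal to it.\<close>
    have w': "\<not> prefix w (f q)" if "q \<in> F" for q
      using w le[OF that] that by (metis prefix_length_le le_antisym not_equal_is_parallel parallel_def)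
    show ?thesis
    proof (intro exI[of _ "f(p := w)"] conjI ballI impI)
      show "length ((f(p := w)) q) + L = length q" if "q \<in> insert p F" for q
        using that f w Lp by (auto simp: l_def)
      show "q = r" if "q \<in> insert p F" "r \<in> insert p F" "prefix ((f(p := w)) q) ((f(p := w)) r)" for q r
        using that f(2) w(2) w' False by (auto split: if_splits)
    qed
  qed
qed

text \<open>Averaging: the \<open>2 ^ L\<close> classes are disjoint and share a total weight of at
  most \<open>1\<close>, so some class has weight at most \<open>2 ^ - L\<close>.\<close>

lemma exists_light_class:
  assumes "finite D" "prefix_free D" "\<And>p. p \<in> D \<Longrightarrow> length p \<le> N"
    and disj: "\<And>p \<beta> \<gamma>. p \<in> D \<Longrightarrow> length \<beta> = L \<Longrightarrow> length \<gamma> = L \<Longrightarrow> C \<beta> p \<Longrightarrow> C \<gamma> p \<Longrightarrow> \<beta> = \<gamma>"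
  shows "\<exists>\<beta> :: bitstring. length \<beta> = L \<and>
    2 ^ L * (\<Sum>p\<in>{p\<in>D. C \<beta> p}. 2 ^ (N - length p)) \<le> (2 ^ N :: nat)"
proof (rule ccontr)
  let ?w = "\<lambda>\<beta>. \<Sum>p\<in>{p\<in>D. C \<beta> p}. (2::nat) ^ (N - length p)"
  let ?B = "{\<beta> :: bitstring. length \<beta> = L}"
  assume "\<not> ?thesis"
  then have gt: "2 ^ N < 2 ^ L * ?w \<beta>" if "\<beta> \<in> ?B" for \<beta>
    using that by (auto simp: not_le)
  have ne: "?B \<noteq> {}" using Ex_list_of_length[of L] by auto
  have "2 ^ L * (2::nat) ^ N = (\<Sum>\<beta>\<in>?B. 2 ^ N)"
    by (simp add: card_bitstrings)
  also have "\<dots> < (\<Sum>\<beta>\<in>?B. 2 ^ L * ?w \<beta>)"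
    using ne gt by (intro sum_strict_mono finite_bitstrings) auto
  also have "\<dots> = 2 ^ L * (\<Sum>\<beta>\<in>?B. ?w \<beta>)" by (simp add: sum_distrib_left)
  also have "(\<Sum>\<beta>\<in>?B. ?w \<beta>) = (\<Sum>p\<in>(\<Union>\<beta>\<in>?B. {p\<in>D. C \<beta> p}). 2 ^ (N - length p))"
    by (rule sum.UNION_disjoint[symmetric]) (use assms finite_bitstrings in auto)
  also have "\<dots> \<le> (\<Sum>p\<in>D. 2 ^ (N - length p))"
    using assms(1) by (intro sum_mono2) auto
  also have "\<dots> \<le> 2 ^ N" using assms by (intro kraft_inequality) auto
  finally show False by simp
qed

section \<open>Complexity bounds and self-delimiting codes\<close>

lemma K_le: "M \<sigma> = Some x \<Longrightarrow> K M x \<le> enat (length \<sigma>)"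
  unfolding K_def by (rule INF_lower) simp

text \<open>An infimum over no programs is infinite, and every other one is attained by a
  program.\<close>

lemma le_K_time:
  assumes "\<And>\<sigma> s. s \<le> t (length x) \<Longrightarrow> runs u (str_code \<sigma>) s (str_code x) \<Longrightarrow> a \<le> enat (length \<sigma>) + c"
  shows "a \<le> K_time u t x + c"
proof (cases "{\<sigma>. \<exists>s\<le>t (length x). runs u (str_code \<sigma>) s (str_code x)} = {}")
  case True
  then show ?thesis unfolding K_time_def by (simp add: top_enat_def del: Collect_empty_eq)
next
  case False
  then obtain k where "k \<in>
      (\<lambda>\<sigma>. enat (length \<sigma>)) ` {\<sigma>. \<exists>s\<le>t (length x). runs u (str_code \<sigma>) s (str_code x)}"
    by blast
  from wellorder_InfI[OF this] show ?thesis unfolding K_time_def using assms by auto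
qed

lemma K_time_antimono: "t (length x) \<le> t' (length x) \<Longrightarrow> K_time u t' x \<le> K_time u t x"
  unfolding K_time_def by (intro INF_superset_mono) (auto intro: order_trans)

text \<open>Turns the equation into bounded conditions on bits, which \<open>dec_nthb\<close> can
  decide.\<close>

lemma eq_replicate_append_iff:
  "\<sigma> = replicate k True @ False # w \<longleftrightarrow> length \<sigma> = k + 1 + length w \<and> (\<forall>i<k. nthb \<sigma> i) \<and>
    \<not> nthb \<sigma> k \<and> (\<forall>i<length w. nthb \<sigma> (k + 1 + i) = nthb w i)"
proof
  assume *: "length \<sigma> = k + 1 + length w \<and> (\<forall>i<k. nthb \<sigma> i) \<and>
    \<not> nthb \<sigma> k \<and> (\<forall>i<length w. nthb \<sigma> (k + 1 + i) = nthb w i)"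
  show "\<sigma> = replicate k True @ False # w"
  proof (rule bitstring_eqI)
    fix i assume "i < length \<sigma>"
    consider "i < k" | "i = k" | "k + 1 \<le> i" by linarith
    then show "nthb \<sigma> i = nthb (replicate k True @ False # w) i"
    proof cases
      case 1
      then show ?thesis using * by (simp add: nthb_def nth_append)
    next
      case 2
      then show ?thesis using * by (simp add: nthb_def nth_append)
    next
      case 3
      then obtain j where "i = k + 1 + j" using le_Suc_ex by blast
      moreover from this have "nthb \<sigma> (k + 1 + j) = nthb w j"
        using * \<open>i < length \<sigma>\<close> by simp
      ultimately show ?thesis by (simp add: nthb_def nth_append)
    qed
  qed (use * in simp)
qed (auto simp: nthb_def nth_append)

lemma dec_eq_replicate_append:
  assumes "computable (\<lambda>x. str_code (F x))" "computable f" "computable (\<lambda>x. str_code (G x))"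
  shows "dec (\<lambda>x. F x = replicate (f x) True @ False # G x)"
  unfolding eq_replicate_append_iff
  by (intro computable_intros assms computable_compose[OF assms(1)] computable_compose[OF assms(2)]
      computable_compose[OF assms(3)])

text \<open>A unary number ended by \<open>False\<close> is self-delimiting.\<close>

lemma prefix_replicate_append:
  "prefix (replicate k True @ False # w) (replicate k' True @ False # w') \<longleftrightarrow> k = k' \<and> prefix w w'"
proof (induction k arbitrary: k')
  case 0
  then show ?case by (cases k') auto
next
  case (Suc k)
  then show ?case by (cases k') auto
qed

lemma optimal_K_le:
  assumes "optimal U" "prefix_free_machine M"
  obtains d where "\<And>\<sigma> x. M \<sigma> = Some x \<Longrightarrow> K U x \<le> enat (length \<sigma> + d)"
proof -
  obtain d where d: "\<And>x. K U x \<le> K M x + enat d"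
    using assms unfolding optimal_def by blast
  have "K U x \<le> enat (length \<sigma> + d)" if "M \<sigma> = Some x" for \<sigma> x
    using d[of x] K_le[where M=M, OF that] by (metis add_right_mono order_trans plus_enat_simps(1))
  then show thesis using that by blast
qed

text \<open>A machine maps \<open>n\<close> ones followed by a zero to the string with code
  \<open>n\<close>. This crude bound is used against programs that are too long to be
  recoded.\<close>

lemma K_le_str_code:
  assumes "optimal U"
  obtains d where "\<And>x. K U x \<le> enat (str_code x + d)"
proof -
  define Q where "Q = (\<lambda>\<sigma> n. \<sigma> = replicate n True @ False # [])"
  define M where "M = (\<lambda>\<sigma>. if \<exists>n. Q \<sigma> n
    then Some (S (p2 (pr (str_code \<sigma>) (LEAST n. Q \<sigma> n)))) else None)"
  have "partial_computable M"
    unfolding M_def Q_def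
    by (intro partial_computable_search dec_eq_replicate_append computable_intros)
  moreover have Q: "Q \<sigma> n \<Longrightarrow> n = k \<longleftrightarrow> Q \<sigma> k" for \<sigma> n k
    using prefix_replicate_append[of n "[]" k "[]"] unfolding Q_def by auto
  have M: "M \<sigma> = Some (S n)" if "Q \<sigma> n" for \<sigma> n
  proof -
    have "Q \<sigma> (LEAST n. Q \<sigma> n)" using that by (rule LeastI)
    then have "(LEAST n. Q \<sigma> n) = n" using Q[OF that, of "LEAST n. Q \<sigma> n"] by simp
    then show ?thesis using that by (auto simp: M_def)
  qed
  have "dom M = {\<sigma>. \<exists>n. Q \<sigma> n}" by (auto simp: M_def split: if_splits)
  then have "prefix_free (dom M)"
    unfolding prefix_free_def strict_prefix_def
    using prefix_replicate_append[where w = "[]" and w' = "[]"] by (auto simp only: Q_def)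
  ultimately have "prefix_free_machine M" by (simp add: prefix_free_machine_def)
  then obtain d where d: "\<And>\<sigma> x. M \<sigma> = Some x \<Longrightarrow> K U x \<le> enat (length \<sigma> + d)"
    using optimal_K_le assms by blast
  have "K U x \<le> enat (str_code x + Suc d)" for x
    using d[OF M[of "replicate (str_code x) True @ [False]" "str_code x"]] by (simp add: Q_def)
  then show thesis using that by blast
qed

section \<open>Computable light blocks\<close>

definition has_block :: "bitstring \<Rightarrow> nat \<Rightarrow> bitstring \<Rightarrow> bool" where
  "has_block y a \<beta> \<longleftrightarrow> a + length \<beta> \<le> length y \<and> (\<forall>i<length \<beta>. nthb y (a + i) = nthb \<beta> i)"

lemma dec_has_block [computable_intros]:
  assumes "computable (\<lambda>x. str_code (F x))" "computable f" "computable (\<lambda>x. str_code (G x))"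
  shows "dec (\<lambda>x. has_block (F x) (f x) (G x))"
  unfolding has_block_def
  by (intro computable_intros assms computable_compose[OF assms(1)] computable_compose[OF assms(2)]
      computable_compose[OF assms(3)])

lemma has_block_unique:
  "has_block y a \<beta> \<Longrightarrow> has_block y a \<gamma> \<Longrightarrow> length \<beta> = length \<gamma> \<Longrightarrow> \<beta> = \<gamma>"
  by (rule bitstring_eqI) (auto simp: has_block_def)

lemma has_block_prefix: "has_block y a \<beta> \<Longrightarrow> prefix y z \<Longrightarrow> has_block z a \<beta>"
  by (auto simp: has_block_def prefix_iff_nthb)

lemma has_block_append: "has_block (y @ \<beta>) (length y) \<beta>"
  by (auto simp: has_block_def nthb_append)

text \<open>Among the \<open>2 ^ (2 * j)\<close> candidates for block \<open>j\<close>, the lightest one is produced by programs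
  of total weight at most \<open>2 ^ - (2 * j)\<close>. These programs can therefore be recoded by prefix-free
  codewords that are shorter by \<open>2 * j\<close>; a prefix announcing \<open>j\<close> costs \<open>j + 1\<close> bits.
  Codewords are found by search, as finite sets of pairs (codeword, program) given by bit strings.\<close>

lemma exists_light_blocks:
  assumes U: "optimal U" "implements u U"
    and "computable pos" "computable T" "computable h"
  obtains B c where "computable (\<lambda>j. str_code (B j))" "\<And>j. length (B j) = 2 * j"
    "\<And>j y. has_block y (pos j) (B j) \<Longrightarrow> str_code y \<le> h j \<Longrightarrow>
      K U y + enat j \<le> K_time u (\<lambda>_. T j) y + enat c"
proof -
  note comp = assms(3-5)[THEN computable_compose]
  \<comment> \<open>Only programs with codes below \<open>R j\<close> are recoded. Every other
    program has length at least \<open>h j + j + 2\<close>, where the bound from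
    \<open>K_le_str_code\<close> suffices.\<close>
  define R where "R j = (2::nat) ^ (h j + j + 2)" for j
  define inF where "inF j \<beta> p \<longleftrightarrow> p < R j \<and> bounded_eval u (T j) p \<noteq> 0 \<and>
    has_block (S (bounded_eval u (T j) p - 1)) (pos j) \<beta>" for j \<beta> p
  \<comment> \<open>A true bit of \<open>a\<close> at \<open>pr w p\<close> assigns the codeword
    \<open>S w\<close> to the program with code \<open>p\<close>. All conditions are bounded, so a
    correct pair of block and assignment can be recognised.\<close>
  define good where "good j \<beta> a \<longleftrightarrow> length \<beta> = 2 * j \<and>
    (\<forall>p<R j. inF j \<beta> p \<longrightarrow> (\<exists>w<length a. nthb a (pr w p))) \<and>
    (\<forall>k<length a. nthb a k \<longrightarrow> inF j \<beta> (p2 k) \<and> length (S (p1 k)) + 2 * j = length (S (p2 k)) \<and>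
      (\<forall>k'<length a. nthb a k' \<and> prefix (S (p1 k)) (S (p1 k')) \<longrightarrow> p2 k = p2 k'))"
    for j \<beta> a
  have cR: "computable (\<lambda>x. R (f x))" if "computable f" for f
    unfolding R_def by (intro computable_intros comp that)
  have cF: "dec (\<lambda>x. inF (f x) (G x) (g x))"
    if "computable f" "computable (\<lambda>x. str_code (G x))" "computable g" for f g G
    unfolding inF_def by (intro computable_intros comp computable_bounded_eval cR that)
  have dgood: "dec (\<lambda>z. good (p1 z) (S (p1 (p2 z))) (S (p2 (p2 z))))"
    unfolding good_def by (intro computable_intros cR cF)

  have U_eval: "U (S p) = Some (S (bounded_eval u s p - 1))" if "bounded_eval u s p \<noteq> 0"
    for p s
  proof -
    obtain y where y: "bounded_eval u s p = Suc y"
      using \<open>bounded_eval u s p \<noteq> 0\<close> by (cases "bounded_eval u s p") auto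
    then obtain s' where "runs u (str_code (S p)) s' (str_code (S y))"
      using bounded_eval_sound by fastforce
    then show ?thesis using U(2) y unfolding implements_def by auto
  qed
  have pf_U: "prefix_free (dom U)"
    using U(1) by (simp add: optimal_def prefix_free_machine_def)

  have ex_good: "\<exists>n. good j (S (p1 n)) (S (p2 n))" for j
  proof -
    define D where "D = {p. str_code p < R j \<and> bounded_eval u (T j) (str_code p) \<noteq> 0}"
    have "D \<subseteq> S ` {..<R j}"
      unfolding D_def by (force intro: image_eqI[where x = "str_code _"])
    then have finD: "finite D" by (rule finite_subset) simp
    have "D \<subseteq> dom U" unfolding D_def using U_eval[of _ "str_code _"] by fastforce
    then have pfD: "prefix_free D" using pf_U unfolding prefix_free_def by blast
    have lenD: "length p \<le> R j" if "p \<in> D" for p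
      using that length_le_str_code[of p] by (simp add: D_def)
    let ?C = "\<lambda>\<beta> p. has_block (S (bounded_eval u (T j) (str_code p) - 1)) (pos j) \<beta>"
    have "\<exists>\<beta>. length \<beta> = 2 * j \<and>
        2 ^ (2 * j) * (\<Sum>p\<in>{p\<in>D. ?C \<beta> p}. 2 ^ (R j - length p)) \<le> (2 ^ R j :: nat)"
      by (rule exists_light_class[OF finD pfD lenD]) (simp_all add: has_block_unique)
    then obtain \<beta> where \<beta>: "length \<beta> = 2 * j"
      "2 ^ (2 * j) * (\<Sum>p\<in>{p\<in>D. ?C \<beta> p}. 2 ^ (R j - length p)) \<le> (2 ^ R j :: nat)"
      by blast
    define F where "F = {p\<in>D. ?C \<beta> p}"
    have F: "p \<in> F \<longleftrightarrow> inF j \<beta> (str_code p)" for p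
      by (auto simp: F_def D_def inF_def)
    have finF: "finite F" and lenF: "\<And>p. p \<in> F \<Longrightarrow> length p \<le> R j"
      using finD lenD by (auto simp: F_def)
    have light: "2 ^ (2 * j) * (\<Sum>p\<in>F. 2 ^ (R j - length p)) \<le> (2 ^ R j :: nat)"
      using \<beta>(2) unfolding F_def .
    obtain f :: "bitstring \<Rightarrow> bitstring" where f: "\<And>p. p \<in> F \<Longrightarrow> length (f p) + 2 * j = length p"
      "\<And>p q. p \<in> F \<Longrightarrow> q \<in> F \<Longrightarrow> prefix (f p) (f q) \<Longrightarrow> p = q"
      using kraft_shortening[OF finF lenF light] by blast
    let ?E = "(\<lambda>p. pr (str_code (f p)) (str_code p)) ` F"
    have finE: "finite ?E" using finF by simp
    \<comment> \<open>The characteristic sequence of the assignment; inserting \<open>0\<close>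
      keeps \<open>Max\<close> defined when \<open>F\<close> is empty.\<close>
    define a where "a = map (\<lambda>i. i \<in> ?E) [0..<Suc (Max (insert 0 ?E))]"
    have nth_a: "nthb a k \<longleftrightarrow> k \<in> ?E" for k
      using Max_ge[of "insert 0 ?E" k] finE unfolding a_def nthb_def
      by (auto simp: less_Suc_eq_le simp del: upt_Suc)
    have "good j \<beta> a"
      unfolding good_def
    proof (intro conjI allI impI)
      fix p assume "inF j \<beta> p"
      then have "S p \<in> F" using F[of "S p"] by simp
      then have "nthb a (pr (str_code (f (S p))) p)" unfolding nth_a by force
      moreover from this have "str_code (f (S p)) < length a"
        using le_prod_encode_1[of "str_code (f (S p))" p] unfolding nthb_def by simp
      ultimately show "\<exists>w<length a. nthb a (pr w p)" by blast
    next
      fix k assume "nthb a k"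
      then obtain p where p: "p \<in> F" "k = pr (str_code (f p)) (str_code p)" unfolding nth_a by blast
      then show "inF j \<beta> (p2 k)" "length (S (p1 k)) + 2 * j = length (S (p2 k))"
        using F f(1) by auto
      fix k' assume "nthb a k' \<and> prefix (S (p1 k)) (S (p1 k'))"
      moreover from this obtain q where "q \<in> F" "k' = pr (str_code (f q)) (str_code q)"
        unfolding nth_a by blast
      ultimately show "p2 k = p2 k'" using f(2)[of p q] p by simp
    qed (rule \<beta>(1))
    then show ?thesis by (intro exI[of _ "pr (str_code \<beta>) (str_code a)"]) simp
  qed

  \<comment> \<open>Taking the first correct certificate makes the block and its recoding computable
    functions of \<open>j\<close>.\<close>
  define n where "n j = (LEAST n. good j (S (p1 n)) (S (p2 n)))" for j
  have cn: "computable n"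
    unfolding n_def using dgood ex_good by (rule computable_LEAST)
  define B where "B j = S (p1 (n j))" for j
  define a where "a j = S (p2 (n j))" for j
  have cB: "computable (\<lambda>j. str_code (B j))"
    unfolding B_def by (intro computable_intros cn)
  have ca: "computable (\<lambda>x. str_code (a (f x)))" if "computable f" for f
    unfolding a_def by (intro computable_intros computable_compose[OF cn] that)
  have good: "good j (B j) (a j)" for j
    unfolding B_def a_def n_def using ex_good by (rule LeastI_ex)
  have a: "inF j (B j) p" "length (S w) + 2 * j = length (S p)"
    "nthb (a j) (pr w' p') \<Longrightarrow> prefix (S w) (S w') \<Longrightarrow> p = p'"
    if "nthb (a j) (pr w p)" for j w p w' p'
  proof -
    have lt: "pr w p < length (a j)" using that by (simp add: nthb_def)
    have *: "\<forall>k<length (a j). nthb (a j) k \<longrightarrow> inF j (B j) (p2 k) \<and>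
        length (S (p1 k)) + 2 * j = length (S (p2 k)) \<and>
        (\<forall>k'<length (a j). nthb (a j) k' \<and> prefix (S (p1 k)) (S (p1 k')) \<longrightarrow> p2 k = p2 k')"
      using good[of j] unfolding good_def by (elim conjE)
    note ** = *[rule_format, OF lt that, unfolded p1_pr p2_pr]
    from ** show "inF j (B j) p" "length (S w) + 2 * j = length (S p)" by blast+
    assume "nthb (a j) (pr w' p')" "prefix (S w) (S w')"
    moreover from this have "pr w' p' < length (a j)" by (simp add: nthb_def)
    ultimately show "p = p'" using ** p1_pr p2_pr by metis
  qed

  \<comment> \<open>An input announces \<open>j\<close> in unary and continues with a codeword. The
    certificate \<open>k\<close> codes \<open>j\<close>, the codeword and its program, which
    \<open>g\<close> evaluates with bound \<open>T j\<close>.\<close>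
  define Q where "Q = (\<lambda>\<sigma> k. \<sigma> = replicate (p1 k) True @ False # S (p1 (p2 k)) \<and>
    nthb (a (p1 k)) (p2 k))"
  define g where "g = (\<lambda>z. bounded_eval u (T (p1 (p2 z))) (p2 (p2 (p2 z))) - 1)"
  define M where "M = (\<lambda>\<sigma>. if \<exists>k. Q \<sigma> k
    then Some (S (g (pr (str_code \<sigma>) (LEAST k. Q \<sigma> k)))) else None)"
  have "partial_computable M"
    unfolding M_def g_def Q_def
    by (intro partial_computable_search dec_eq_replicate_append computable_intros
        computable_bounded_eval comp ca)
  have Q_prefix: "k = k'" if Q: "Q \<sigma> k" "Q \<sigma>' k'" and p: "prefix \<sigma> \<sigma>'" for \<sigma> \<sigma>' k k'
  proof -
    obtain j w q j' w' q' where k: "k = pr j (pr w q)" "k' = pr j' (pr w' q')"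
      by (metis pr_p1_p2)
    then have w: "j = j'" "prefix (S w) (S w')"
      using Q p prefix_replicate_append by (auto simp: Q_def)
    then have "q = q'" using Q k a(3)[of j w q w' q'] by (auto simp: Q_def)
    \<comment> \<open>Codewords of the same program have equal length, so comparable ones
      coincide.\<close>
    moreover have "length (S w) = length (S w')"
      using Q k w \<open>q = q'\<close> a(2)[of j w q] a(2)[of j w' q] by (auto simp: Q_def)
    then have "S w = S w'" using w(2) by (auto simp: prefix_def)
    then have "w = w'" by (metis str_code_S)
    ultimately show ?thesis using k w by simp
  qed
  have M: "M \<sigma> = U (S p)" if "Q \<sigma> (pr j (pr w p))" for \<sigma> j w p
  proof -
    have "Q \<sigma> (LEAST k. Q \<sigma> k)" using that by (rule LeastI)
    then have "(LEAST k. Q \<sigma> k) = pr j (pr w p)" using Q_prefix that by blast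
    moreover have "bounded_eval u (T j) p \<noteq> 0"
      using that a(1)[of j w p] by (simp add: Q_def inF_def)
    ultimately show ?thesis using that U_eval[of "T j" p] by (auto simp: M_def g_def)
  qed
  have "prefix_free (dom M)"
    unfolding prefix_free_def strict_prefix_def
  proof (intro ballI notI)
    fix \<sigma> \<tau> assume *: "\<sigma> \<in> dom M" "\<tau> \<in> dom M" "prefix \<sigma> \<tau> \<and> \<sigma> \<noteq> \<tau>"
    then obtain k k' where "Q \<sigma> k" "Q \<tau> k'" by (auto simp: M_def split: if_splits)
    with * Q_prefix[of \<sigma> k \<tau> k'] show False by (auto simp: Q_def)
  qed
  then have "prefix_free_machine M"
    using \<open>partial_computable M\<close> by (simp add: prefix_free_machine_def)
  then obtain d where d: "\<And>\<sigma> x. M \<sigma> = Some x \<Longrightarrow> K U x \<le> enat (length \<sigma> + d)"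
    using optimal_K_le U(1) by blast
  obtain d' where d': "\<And>x. K U x \<le> enat (str_code x + d')"
    using K_le_str_code U(1) by blast

  have "K U y + enat j \<le> K_time u (\<lambda>_. T j) y + enat (Suc d + d')"
    if block: "has_block y (pos j) (B j)" and y: "str_code y \<le> h j" for j y
  proof (rule le_K_time)
    fix \<sigma> s assume s: "s \<le> T j" "runs u (str_code \<sigma>) s (str_code y)"
    show "K U y + enat j \<le> enat (length \<sigma>) + enat (Suc d + d')"
    proof (cases "str_code \<sigma> < R j")
      case True
      have "bounded_eval u (T j) (str_code \<sigma>) = Suc (str_code y)"
        using bounded_eval_complete s by blast
      then have "inF j (B j) (str_code \<sigma>)"
        using True block by (simp add: inF_def)
      then obtain w where w: "nthb (a j) (pr w (str_code \<sigma>))"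
        using good[of j] True unfolding good_def by blast
      define \<tau> where "\<tau> = replicate j True @ False # S w"
      have "M \<tau> = U (S (str_code \<sigma>))"
        by (rule M[of _ j w]) (simp add: Q_def w \<tau>_def)
      also have "U (S (str_code \<sigma>)) = Some y"
        using U(2) s(2) unfolding implements_def by auto
      finally have "K U y \<le> enat (length \<tau> + d)" by (rule d)
      then have "K U y + enat j \<le> enat (length \<tau> + d) + enat j" by (rule add_right_mono)
      \<comment> \<open>The announcement costs \<open>j + 1\<close> bits and the codeword saves
        \<open>2 * j\<close>, a gain of \<open>j\<close> up to constants.\<close>
      also have "\<dots> \<le> enat (length \<sigma>) + enat (Suc d + d')"
        using a(2)[OF w] by (simp add: \<tau>_def)
      finally show ?thesis .
    next
      case False
      then have "(2::nat) ^ (h j + j + 2) < 2 ^ Suc (length \<sigma>)"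
        using str_code_bounds(2)[of \<sigma>] by (simp add: R_def)
      then have len: "h j + j + 2 < Suc (length \<sigma>)"
        by (rule power_less_imp_less_exp[rotated]) simp
      have "K U y + enat j \<le> enat (str_code y + d') + enat j"
        using d' by (rule add_right_mono)
      also have "\<dots> \<le> enat (length \<sigma>) + enat (Suc d + d')"
        using len y by simp
      finally show ?thesis .
    qed
  qed
  then show thesis using that[of B "Suc d + d'"] cB good unfolding good_def by blast
qed

subsection \<open>Deep extensions\<close>

definition good :: "(bitstring \<rightharpoonup> bitstring) \<Rightarrow> prog \<Rightarrow> (nat \<Rightarrow> nat) \<Rightarrow> nat \<Rightarrow> bitstring \<Rightarrow> bool" where
  "good U u t e y \<longleftrightarrow> K U y + enat e \<le> K_time u t y"

lemma good_mono:
  assumes "good U u t' e' y" "e \<le> e'" "t (length y) \<le> t' (length y)"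
  shows "good U u t e y"
proof -
  have "K U y + enat e \<le> K U y + enat e'" using assms(2) by (intro add_left_mono) simp
  also have "\<dots> \<le> K_time u t' y" using assms(1) by (simp add: good_def)
  also have "\<dots> \<le> K_time u t y" using assms(3) by (rule K_time_antimono)
  finally show ?thesis by (simp add: good_def)
qed

text \<open>The gap \<open>j\<close> gained from a light block absorbs the constant \<open>c\<close>
  once \<open>j\<close> is large.\<close>

lemma good_if_light:
  assumes "K U y + enat j \<le> K_time u (\<lambda>_. T) y + enat c" "c + e \<le> j" "t (length y) \<le> T"
  shows "good U u t e y"
proof -
  have "K_time u (\<lambda>_. T) y \<le> K_time u t y" using assms(3) by (rule K_time_antimono)
  then show ?thesis using assms(1,2) unfolding good_def
    by (cases "K U y"; cases "K_time u (\<lambda>_. T) y"; cases "K_time u t y") auto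
qed

text \<open>The positions are divided into consecutive blocks of lengths \<open>2, 2, 4, 4, 6, 6, \<dots>\<close>. Up to a
  finite part, the first block of length \<open>2 * j\<close>, at \<open>pos0 j\<close>, always serves depth, while the second
  one, at \<open>pos1 j\<close>, is free and is used at most once, to bridge the way to an element of a
  computably enumerable set.\<close>

definition pos0 :: "nat \<Rightarrow> nat" where
  "pos0 j = 2 * j * (j - 1)"

definition pos1 :: "nat \<Rightarrow> nat" where
  "pos1 j = 2 * j * j"

lemma pos0_add: "pos0 j + 2 * j = pos1 j"
  by (cases j) (auto simp: pos0_def pos1_def)

lemma pos1_add: "pos1 j + 2 * j = pos0 (Suc j)"
  by (auto simp: pos0_def pos1_def)

lemma pos0_mono: "i \<le> j \<Longrightarrow> pos0 i \<le> pos0 j"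
  unfolding pos0_def by (intro mult_le_mono) auto

lemma pos1_mono: "i \<le> j \<Longrightarrow> pos1 i \<le> pos1 j"
  unfolding pos1_def by (intro mult_le_mono) auto

lemma pos1_le_pos0: "i < j \<Longrightarrow> pos1 i \<le> pos0 j"
  using pos1_add[of i] pos0_mono[of "Suc i" j] by simp

lemma pos0_le_pos1: "i \<le> j \<Longrightarrow> pos0 i \<le> pos1 j"
  using pos0_add[of j] pos0_mono[of i j] by simp

lemma le_pos1: "j \<le> pos1 j"
  by (cases j) (auto simp: pos1_def)

lemma le_pos0: "j \<le> pos0 (Suc j)"
  by (auto simp: pos0_def)

lemma computable_pos [computable_intros]:
  "computable f \<Longrightarrow> computable (\<lambda>x. pos0 (f x))"
  "computable f \<Longrightarrow> computable (\<lambda>x. pos1 (f x))"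
  unfolding pos0_def pos1_def by (intro computable_intros; assumption)+

text \<open>The first block of length \<open>2 * j\<close> ends at \<open>pos1 j\<close>. This picks
  the last such block that is complete at length \<open>n\<close>, the one in charge there.\<close>

lemma between_pos1:
  assumes "pos1 i \<le> n"
  obtains j where "i \<le> j" "pos1 j \<le> n" "n < pos1 (Suc j)"
proof -
  define j where "j = (LEAST k. n < pos1 (Suc k))"
  have j: "n < pos1 (Suc j)" unfolding j_def
    by (rule LeastI[of _ n]) (use le_pos1[of "Suc n"] in simp)
  have "pos1 j \<le> n"
  proof (cases j)
    case (Suc k)
    then have "k < j" by simp
    then have "\<not> n < pos1 (Suc k)" unfolding j_def by (rule not_less_Least)
    then show ?thesis using Suc by simp
  qed (simp add: pos1_def)
  moreover have "i \<le> j"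
    using assms j pos1_mono[of "Suc j" i] by (cases "i \<le> j") auto
  ultimately show thesis using that j by blast
qed

text \<open>The blocks \<open>B\<close> are computable so that the next stage can search the tree of
  strings that carry them. Only blocks from \<open>J\<close> on that are complete in
  \<open>y\<close> are prescribed; all other bits after \<open>\<sigma>\<close> are free.\<close>

definition controlled :: "(bitstring \<rightharpoonup> bitstring) \<Rightarrow> prog \<Rightarrow> (nat \<Rightarrow> nat) \<Rightarrow> nat \<Rightarrow> bitstring \<Rightarrow> bool" where
  "controlled U u t e \<sigma> \<longleftrightarrow> (\<exists>B J. computable (\<lambda>j. str_code (B j)) \<and> (\<forall>j. length (B j) = 2 * j) \<and>
    length \<sigma> \<le> pos0 J \<and>
    (\<forall>y. prefix \<sigma> y \<longrightarrow> (\<forall>j\<ge>J. pos1 j \<le> length y \<longrightarrow> has_block y (pos0 j) (B j)) \<longrightarrow> good U u t e y))"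

lemma controlled_good:
  assumes "controlled U u t e \<sigma>"
  shows "good U u t e \<sigma>"
proof -
  obtain B J where B: "\<And>j. length (B j :: bitstring) = 2 * j" "length \<sigma> \<le> pos0 J"
    "\<And>y. prefix \<sigma> y \<Longrightarrow> (\<forall>j\<ge>J. pos1 j \<le> length y \<longrightarrow> has_block y (pos0 j) (B j)) \<Longrightarrow> good U u t e y"
    using assms unfolding controlled_def by blast
  have "has_block \<sigma> (pos0 j) (B j)" if "J \<le> j" "pos1 j \<le> length \<sigma>" for j
  proof -
    \<comment> \<open>As \<open>\<sigma>\<close> ends before block \<open>J\<close>, only the empty
      block \<open>0\<close> can be complete in it.\<close>
    have "j = 0" using that B(2) pos0_mono[OF that(1)] pos0_add[of j] by simp
    then show ?thesis using B(1)[of 0] by (simp add: has_block_def pos0_def)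
  qed
  then show ?thesis using B(3) by blast
qed

text \<open>Block \<open>j\<close> is in charge of lengths from its end \<open>pos1 j\<close> until
  block \<open>Suc j\<close> is complete at \<open>pos1 (Suc j)\<close>. As \<open>t\<close> is
  monotone, the value \<open>t (pos1 (Suc j))\<close> bounds the time on all these lengths.\<close>

lemma exists_controlled:
  assumes "optimal U" "implements u U" "computable t" "mono t"
  obtains C where "\<And>j \<sigma>. C \<le> j \<Longrightarrow> length \<sigma> = pos0 j \<Longrightarrow>
    \<exists>\<beta>. length \<beta> = 2 * j \<and> controlled U u t e (\<sigma> @ \<beta>)"
proof -
  obtain B c where B: "computable (\<lambda>j. str_code (B j))" "\<And>j. length (B j) = 2 * j"
    "\<And>j y. has_block y (pos0 j) (B j) \<Longrightarrow> str_code y \<le> 2 ^ Suc (pos1 (Suc j)) \<Longrightarrow>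
      K U y + enat j \<le> K_time u (\<lambda>_. t (pos1 (Suc j))) y + enat c"
  proof (rule exists_light_blocks[OF assms(1,2)])
    show "computable pos0" "computable (\<lambda>j. t (pos1 (Suc j)))" "computable (\<lambda>j. 2 ^ Suc (pos1 (Suc j)))"
      by (intro computable_intros computable_compose[OF assms(3)])+
  qed blast
  show thesis
  proof (rule that[of "c + e"])
    fix j and \<sigma> :: bitstring assume j: "c + e \<le> j" "length \<sigma> = pos0 j"
    have "good U u t e y" if y: "prefix (\<sigma> @ B j) y"
      and conf: "\<forall>i\<ge>Suc j. pos1 i \<le> length y \<longrightarrow> has_block y (pos0 i) (B i)" for y
    proof -
      have "pos1 j \<le> length y"
        using prefix_length_le[OF y] j B(2) pos0_add[of j] by simp
      then obtain i where i: "j \<le> i" "pos1 i \<le> length y" "length y < pos1 (Suc i)"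
        by (rule between_pos1)
      have "has_block y (pos0 i) (B i)"
      proof (cases "i = j")
        case True
        then show ?thesis using has_block_prefix[OF has_block_append y] j by simp
      next
        case False
        then show ?thesis using conf i by simp
      qed
      moreover have "str_code y \<le> 2 ^ Suc (pos1 (Suc i))"
      proof -
        have "str_code y \<le> 2 ^ Suc (length y)" using str_code_bounds(2)[of y] by simp
        also have "\<dots> \<le> 2 ^ Suc (pos1 (Suc i))" using i by (intro power_increasing) auto
        finally show ?thesis .
      qed
      ultimately have "K U y + enat i \<le> K_time u (\<lambda>_. t (pos1 (Suc i))) y + enat c"
        by (rule B(3))
      then show ?thesis
        using i j by (elim good_if_light) (auto intro: monoD[OF assms(4)])
    qed
    then show "\<exists>\<beta>. length \<beta> = 2 * j \<and> controlled U u t e (\<sigma> @ \<beta>)"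
      unfolding controlled_def using B(1,2) j pos0_add[of j] pos1_le_pos0[of j "Suc j"]
      by (intro exI[of _ "B j"] conjI exI[of _ B] exI[of _ "Suc j"]) auto
  qed
qed

section \<open>One stage of the construction\<close>

definition decides :: "bitstring \<Rightarrow> bitstring set \<Rightarrow> bool" where
  "decides \<sigma> W \<longleftrightarrow> (\<exists>\<rho>\<in>W. prefix \<rho> \<sigma>) \<or> (\<forall>\<tau>. prefix \<sigma> \<tau> \<longrightarrow> \<tau> \<notin> W)"

text \<open>Control passes from \<open>t\<close> to the larger bound \<open>t'\<close> only at
  \<open>\<sigma>'\<close>. Goodness of all strings between \<open>\<sigma>\<close> and
  \<open>\<sigma>'\<close> is what depth of the limit will use.\<close>

lemma exists_deciding_extension:
  assumes U: "optimal U" "implements u U"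
    and t: "computable t" "mono t" and t': "computable t'" "mono t'" "\<And>n. t n \<le> t' n"
    and W: "ce_set W" and \<sigma>: "controlled U u t e \<sigma>"
  shows "\<exists>\<sigma>'. prefix \<sigma> \<sigma>' \<and> length \<sigma> < length \<sigma>' \<and> controlled U u t' (Suc e) \<sigma>' \<and>
    (\<forall>y. prefix \<sigma> y \<longrightarrow> prefix y \<sigma>' \<longrightarrow> good U u t e y) \<and> decides \<sigma>' W"
proof -
  obtain B J where B: "computable (\<lambda>j. str_code (B j))" "\<And>j. length (B j) = 2 * j"
    and J: "length \<sigma> \<le> pos0 J" and B_good: "\<And>y. prefix \<sigma> y \<Longrightarrow>
      (\<And>j. J \<le> j \<Longrightarrow> pos1 j \<le> length y \<Longrightarrow> has_block y (pos0 j) (B j)) \<Longrightarrow> good U u t e y"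
    using \<sigma> unfolding controlled_def by metis
  obtain C where C: "\<And>j \<rho>. C \<le> j \<Longrightarrow> length \<rho> = pos0 j \<Longrightarrow>
      \<exists>\<beta>. length \<beta> = 2 * j \<and> controlled U u t' (Suc e) (\<rho> @ \<beta>)"
    using exists_controlled[OF U t'(1,2)] by blast
  \<comment> \<open>Unlike the condition in \<^const>\<open>controlled\<close>, this one also constrains incomplete blocks, so that
    the tree of strings that satisfy it has no dead ends.\<close>
  define conf where "conf y \<longleftrightarrow>
      (\<forall>j\<ge>J. \<forall>i<2 * j. pos0 j + i < length y \<longrightarrow> nthb y (pos0 j + i) = nthb (B j) i)" for y
  have block: "has_block y (pos0 j) (B j)" if "conf z" "prefix z y" "J \<le> j" "pos1 j \<le> length z" for y z j
    using that B(2)[of j] pos0_add[of j]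
    by (intro has_block_prefix[OF _ that(2)]) (auto simp: has_block_def conf_def)
  have conf_good: "good U u t e y" if "prefix \<sigma> y" "conf y" for y
    using B_good[OF that(1)] block[OF that(2) prefix_order.refl] by blast
  have conf_prefix: "conf y" if "conf z" "prefix y z" for y z
    using that by (auto simp: conf_def prefix_iff_nthb)
  have disjoint: "j = j'" if "pos0 j + i = pos0 j' + i'" "i < 2 * j" "i' < 2 * j'" for j j' i i'
    using that pos0_add[of j] pos0_add[of j'] pos1_le_pos0[of j j'] pos1_le_pos0[of j' j]
    by (cases j j' rule: linorder_cases) auto
  have conf_extend: "\<exists>z. length z = n \<and> prefix y z \<and> conf z" if "conf y" "length y \<le> n" for y n
  proof -
    \<comment> \<open>Bits prescribed by a block are copied from it and the others set to
      \<open>False\<close>; by \<open>disjoint\<close> no bit is prescribed twice.\<close>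
    define z where "z = y @ map (\<lambda>i. \<exists>j\<ge>J. \<exists>k<2 * j. i = pos0 j + k \<and> nthb (B j) k) [length y..<n]"
    have "length z = n" using that by (simp add: z_def)
    moreover have "conf z"
      unfolding conf_def
    proof (intro allI impI)
      fix j i assume ji: "J \<le> j" "i < 2 * j" "pos0 j + i < length z"
      show "nthb z (pos0 j + i) = nthb (B j) i"
      proof (cases "pos0 j + i < length y")
        case True
        then show ?thesis using \<open>conf y\<close> ji by (simp add: z_def nthb_append conf_def)
      next
        case False
        then have "nthb z (pos0 j + i) \<longleftrightarrow>
            (\<exists>j'\<ge>J. \<exists>k<2 * j'. pos0 j + i = pos0 j' + k \<and> nthb (B j') k)"
          using ji \<open>length z = n\<close>
          by (simp add: nthb_eq_nth[of _ z]) (simp add: z_def nth_append)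
        also have "\<dots> \<longleftrightarrow> nthb (B j) i"
          using ji disjoint by (metis add_left_cancel)
        finally show ?thesis .
      qed
    qed
    moreover have "prefix y z" by (simp add: z_def)
    ultimately show ?thesis by blast
  qed
  have conf_\<sigma>: "conf \<sigma>"
    using J pos0_mono[of J] by (force simp: conf_def)

  show ?thesis
  proof (cases "\<exists>\<rho>. prefix \<sigma> \<rho> \<and> conf \<rho> \<and> (\<forall>\<tau>. prefix \<rho> \<tau> \<longrightarrow> \<tau> \<notin> W)")
    case True
    then obtain \<rho> where \<rho>: "prefix \<sigma> \<rho>" "conf \<rho>" "\<And>\<tau>. prefix \<rho> \<tau> \<Longrightarrow> \<tau> \<notin> W" by blast
    \<comment> \<open>Large enough for \<open>C\<close> to provide control for \<open>t'\<close>,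
      and for block \<open>j\<close> to begin after \<open>\<rho>\<close>.\<close>
    define j where "j = Suc (C + length \<rho>)"
    have len: "length \<rho> \<le> pos0 j" using le_pos0[of "C + length \<rho>"] by (simp add: j_def)
    then obtain z where z: "length z = pos0 j" "prefix \<rho> z" "conf z"
      using conf_extend \<rho>(2) by blast
    obtain \<beta> where \<beta>: "length \<beta> = 2 * j" "controlled U u t' (Suc e) (z @ \<beta>)"
      using C[of j z] z by (auto simp: j_def)
    have "good U u t e y" if y: "prefix \<sigma> y" "prefix y (z @ \<beta>)" for y
    \<comment> \<open>The new block \<open>\<beta>\<close> may differ from \<open>B j\<close>. This
      does no harm: a proper prefix of \<open>z @ \<beta>\<close> completes only blocks before
      \<open>j\<close>, which lie in \<open>z\<close>, and the full string is controlled for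
      \<open>t'\<close>.\<close>
    proof (cases "y = z @ \<beta>")
      case True
      then show ?thesis using good_mono[OF controlled_good[OF \<beta>(2)]] t'(3) by simp
    next
      case False
      have y_len: "length y < pos1 j"
      proof -
        have "strict_prefix y (z @ \<beta>)" using y(2) False by (simp add: strict_prefix_def)
        from prefix_length_less[OF this] show ?thesis
          using \<beta>(1) z(1) pos0_add[of j] by simp
      qed
      consider "prefix y z" | "prefix z y" using prefix_same_cases[OF y(2), of z] by auto
      then show ?thesis
      proof cases
        case 1
        then show ?thesis using conf_good conf_prefix z(3) y(1) by blast
      next
        case 2
        show ?thesis
        proof (rule B_good[OF y(1)])
          fix i assume i: "J \<le> i" "pos1 i \<le> length y"
          then have "i < j" using y_len pos1_mono[of j i] by (cases "i < j") auto
          then show "has_block y (pos0 i) (B i)"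
            using block[OF z(3) 2 i(1)] pos1_le_pos0 z(1) by simp
        qed
      qed
    qed
    moreover have "decides (z @ \<beta>) W"
      using \<rho>(3) z(2) prefix_order.trans[of \<rho> "z @ \<beta>"] unfolding decides_def by (meson prefix_prefix)
    moreover have "prefix \<sigma> (z @ \<beta>)"
      using \<rho>(1) z(2) prefix_order.trans by (metis prefixI)
    moreover have "length \<sigma> < length (z @ \<beta>)"
      using prefix_length_le[OF \<rho>(1)] prefix_length_le[OF z(2)] \<beta>(1) by (simp add: j_def)
    ultimately show ?thesis using \<beta>(2) by blast
  next
    case False
    then have ext: "\<exists>\<tau>\<in>W. prefix \<rho> \<tau>" if "prefix \<sigma> \<rho>" "conf \<rho>" for \<rho>
      using that by blast
    obtain M w where w: "implements w M" "W = dom M"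
      using W unfolding ce_set_def partial_computable_def by blast
    \<comment> \<open>Level \<open>j\<close> of the tree, up to the end of the second block of
      length \<open>2 * j\<close>, written with bounded quantifiers to be decidable;
      \<open>tree_iff\<close> relates it to \<open>conf\<close>.\<close>
    define tree where "tree j \<rho> \<longleftrightarrow> length \<rho> = pos0 (Suc j) \<and> prefix \<sigma> \<rho> \<and>
        (\<forall>k<Suc j. J \<le> k \<longrightarrow> (\<forall>i<2 * k. nthb \<rho> (pos0 k + i) = nthb (B k) i))" for j \<rho>
    define reach where "reach \<rho> s \<longleftrightarrow> (\<exists>x<s. prefix \<rho> (S x) \<and> bounded_eval w s x \<noteq> 0)" for \<rho> s
    define H where "H j = (LEAST s. \<forall>x<2 ^ Suc (pos0 (Suc j)). tree j (S x) \<longrightarrow> reach (S x) s)" for j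
    have tree_iff: "tree j \<rho> \<longleftrightarrow> length \<rho> = pos0 (Suc j) \<and> prefix \<sigma> \<rho> \<and> conf \<rho>" for j \<rho>
    proof -
      have "pos0 k + i < pos0 (Suc j) \<longleftrightarrow> k < Suc j" if "i < 2 * k" for i k
      proof (cases "k < Suc j")
        case True
        then show ?thesis using that pos0_add[of k] pos1_le_pos0[of k "Suc j"] by simp
      next
        case False
        then show ?thesis using pos0_mono[of "Suc j" k] by simp
      qed
      then show ?thesis unfolding tree_def conf_def by (auto 0 3)
    qed
    \<comment> \<open>That all large bounds work for a single node yields one bound for the finitely
      many nodes of a level. This is the compactness argument, and \<open>H\<close> is the resulting
      bound.\<close>
    have reach: "\<forall>\<^sub>F s in sequentially. reach \<rho> s" if \<rho>: "tree j \<rho>" for j \<rho>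
    proof -
      obtain \<tau> where \<tau>: "\<tau> \<in> W" "prefix \<rho> \<tau>" using ext \<rho> tree_iff by blast
      then obtain z where "M \<tau> = Some z" using w by auto
      then obtain s' where s': "runs w (str_code \<tau>) s' (str_code z)"
        using w unfolding implements_def by blast
      have "reach \<rho> s" if "s' + Suc (str_code \<tau>) \<le> s" for s
        unfolding reach_def using that \<tau> bounded_eval_complete[OF s', of s]
        by (intro exI[of _ "str_code \<tau>"]) simp
      then show ?thesis unfolding eventually_sequentially by blast
    qed
    have ex_H: "\<exists>s. \<forall>x<2 ^ Suc (pos0 (Suc j)). tree j (S x) \<longrightarrow> reach (S x) s" for j
    proof -
      have "\<forall>\<^sub>F s in sequentially. \<forall>x\<in>{..<2 ^ Suc (pos0 (Suc j))}. tree j (S x) \<longrightarrow> reach (S x) s"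
        by (intro eventually_ball_finite ballI) (use reach in \<open>auto elim: eventually_mono\<close>)
      then show ?thesis using eventually_happens' by force
    qed
    have cH: "computable H"
      unfolding H_def tree_def reach_def
      by (rule computable_LEAST[OF _ ex_H[unfolded tree_def reach_def]])
        (intro computable_intros computable_bounded_eval computable_compose[OF B(1)])
    have H: "reach \<rho> (H j)" if "tree j \<rho>" for j \<rho>
    proof -
      have "str_code \<rho> < 2 ^ Suc (pos0 (Suc j))"
        using str_code_bounds(2)[of \<rho>] that by (simp add: tree_def)
      then show ?thesis using LeastI_ex[OF ex_H[of j]] that unfolding H_def[symmetric] by fastforce
    qed

    \<comment> \<open>The element of \<open>W\<close> found has a code, hence a length, below
      \<open>H j\<close>, so it ends before block \<open>i j\<close>. The summand \<open>j\<close>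
      ensures \<open>C \<le> i j\<close>.\<close>
    define i where "i j = Suc (H j + j)" for j
    have ci: "computable (\<lambda>x. i (f x))" if "computable f" for f
      unfolding i_def by (intro computable_intros computable_compose[OF cH] that)
    obtain B' c where B': "\<And>j. length (B' j) = 2 * j"
      "\<And>j y. has_block y (pos1 j) (B' j) \<Longrightarrow> str_code y \<le> 2 ^ Suc (pos1 (i j)) \<Longrightarrow>
        K U y + enat j \<le> K_time u (\<lambda>_. t (pos1 (i j))) y + enat c"
    proof (rule exists_light_blocks[OF U])
      show "computable pos1" "computable (\<lambda>j. t (pos1 (i j)))" "computable (\<lambda>j. 2 ^ Suc (pos1 (i j)))"
        by (intro computable_intros computable_compose[OF t(1)] ci)+
    qed blast
    \<comment> \<open>\<open>J\<close> lets the tree condition start by block \<open>j\<close>,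
      \<open>c + e\<close> yields gap \<open>e\<close> after paying the constant, and
      \<open>C\<close> provides control for \<open>t'\<close>.\<close>
    define j where "j = J + c + e + C"
    have "length \<sigma> \<le> pos1 j" using J pos0_le_pos1[of J j] by (simp add: j_def)
    then obtain z where z: "length z = pos1 j" "prefix \<sigma> z" "conf z"
      using conf_extend conf_\<sigma> by blast
    \<comment> \<open>The bridging block occupies the free position \<open>pos1 j\<close>, which the
      tree leaves open. Hence \<open>\<rho>\<close> is still a node of level \<open>j\<close>, and
      \<open>H j\<close> bounds the search above it.\<close>
    define \<rho> where "\<rho> = z @ B' j"
    have \<sigma>_\<rho>: "prefix \<sigma> \<rho>" using z(2) by (simp add: \<rho>_def)
    have \<rho>_len: "length \<rho> = pos0 (Suc j)" using z(1) B'(1) pos1_add[of j] by (simp add: \<rho>_def)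
    have "nthb \<rho> (pos0 k + l) = nthb (B k) l" if "k < Suc j" "J \<le> k" "l < 2 * k" for k l
    proof -
      have "pos0 k + l < length z" using that z(1) pos0_add[of k] pos1_mono[of k j] by simp
      then show ?thesis using z(3) that by (simp add: \<rho>_def nthb_append conf_def)
    qed
    then have tree: "tree j \<rho>" using \<sigma>_\<rho> \<rho>_len by (simp add: tree_def)
    then obtain x where x: "x < H j" "prefix \<rho> (S x)" "bounded_eval w (H j) x \<noteq> 0"
      using H unfolding reach_def by blast
    define \<tau> where "\<tau> = S x"
    have "\<tau> \<in> W"
    proof -
      obtain v where "bounded_eval w (H j) x = Suc v"
        using x(3) by (cases "bounded_eval w (H j) x") auto
      then obtain s where "runs w (str_code \<tau>) s (str_code (S v))"
        using bounded_eval_sound unfolding \<tau>_def by fastforce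
      then show ?thesis using w unfolding implements_def by blast
    qed
    have "length \<tau> \<le> pos0 (i j)"
      using length_le_str_code[of \<tau>] x(1) le_pos0[of "H j + j"] by (simp add: \<tau>_def i_def)
    \<comment> \<open>The padding up to block \<open>i j\<close> is arbitrary, since the bridging
      block keeps all strings up to length \<open>pos1 (i j)\<close> good.\<close>
    then obtain z' where z': "length z' = pos0 (i j)" "prefix \<tau> z'"
      by (intro that[of "\<tau> @ replicate (pos0 (i j) - length \<tau>) False"]) auto
    obtain \<beta> where \<beta>: "length \<beta> = 2 * i j" "controlled U u t' (Suc e) (z' @ \<beta>)"
      using C[of "i j" z'] z' by (auto simp: i_def j_def)
    have \<rho>_z': "prefix \<rho> (z' @ \<beta>)"
      using x(2) z'(2) unfolding \<tau>_def by (metis prefixI prefix_order.trans)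
    have "good U u t e y" if y: "prefix \<sigma> y" "prefix y (z' @ \<beta>)" for y
    proof -
      consider "prefix y \<rho>" | "prefix \<rho> y" using y(2) \<rho>_z' prefix_same_cases by blast
      then show ?thesis
      proof cases
        case 1
        then show ?thesis using conf_good conf_prefix tree y(1) unfolding tree_iff by blast
      next
        case 2
        have block': "has_block y (pos1 j) (B' j)"
          using has_block_prefix[OF has_block_append 2[unfolded \<rho>_def]] z(1) by simp
        have y_len: "length y \<le> pos1 (i j)"
          using prefix_length_le[OF y(2)] z'(1) \<beta>(1) pos0_add[of "i j"] by simp
        have "str_code y \<le> 2 ^ Suc (length y)" using str_code_bounds(2)[of y] by simp
        also have "\<dots> \<le> 2 ^ Suc (pos1 (i j))" using y_len by (intro power_increasing) auto
        finally show ?thesis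
          using y_len by (intro good_if_light[OF B'(2)[OF block']] monoD[OF t(2)]) (auto simp: j_def)
      qed
    qed
    moreover have "decides (z' @ \<beta>) W"
      using \<open>\<tau> \<in> W\<close> z'(2) unfolding decides_def by (metis prefixI prefix_order.trans)
    moreover have "prefix \<sigma> (z' @ \<beta>)"
      using \<sigma>_\<rho> \<rho>_z' by (rule prefix_order.trans)
    moreover have "length \<sigma> < length (z' @ \<beta>)"
      using prefix_length_le[OF \<sigma>_\<rho>] prefix_length_le[OF x(2)] prefix_length_le[OF z'(2)] \<beta>(1)
      by (simp add: \<tau>_def i_def)
    ultimately show ?thesis using \<beta>(2) by blast
  qed
qed

section \<open>Enumeration of the requirements and the limit\<close>

instance prog :: countable
  by countable_datatype

text \<open>A program determines at most one total function, so there are countably many computable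
  functions. Computability is claimed for each \<open>t e\<close>, not uniformly in
  \<open>e\<close>.\<close>

lemma exists_monotone_bounds:
  obtains t :: "nat \<Rightarrow> nat \<Rightarrow> nat" where "\<And>e. computable (t e)" "\<And>e. mono (t e)"
    "\<And>e e' n. e \<le> e' \<Longrightarrow> t e n \<le> t e' n" "\<And>f. computable f \<Longrightarrow> \<exists>e. \<forall>n. f n \<le> t e n"
proof -
  have "{f. computable f} \<subseteq> range (\<lambda>p n. THE y. \<exists>s. runs p n s y)"
  proof safe
    fix f assume "computable f"
    then obtain p where "\<And>n. \<exists>s. runs p n s (f n)" unfolding computable_def by blast
    then have "f = (\<lambda>n. THE y. \<exists>s. runs p n s y)"
      using runs_deterministic by (intro ext the_equality[symmetric]) blast+
    then show "f \<in> range (\<lambda>p n. THE y. \<exists>s. runs p n s y)" by blast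
  qed
  then have count: "countable {f. computable f}" by (rule countable_subset) simp
  have ne: "{f. computable f} \<noteq> {}" using computable_id by blast
  define g where "g = from_nat_into {f. computable f}"
  have g: "computable (g i)" for i
    using from_nat_into[OF ne] unfolding g_def by blast
  \<comment> \<open>Summing over earlier functions and earlier arguments gives monotonicity in both
    \<open>e\<close> and \<open>n\<close>, and \<open>t e\<close> dominates \<open>g i\<close> for
    \<open>i \<le> e\<close>.\<close>
  define t where "t e n = (\<Sum>i<Suc e. \<Sum>k<Suc n. g i k)" for e n
  show thesis
  proof
    show "computable (t e)" for e
    proof (induction e)
      case 0
      show ?case unfolding t_def by (simp del: sum.lessThan_Suc add: lessThan_Suc[of 0])
        (intro computable_intros computable_compose[OF g])
    next
      case (Suc e)
      have "t (Suc e) = (\<lambda>n. t e n + (\<Sum>k<Suc n. g (Suc e) k))"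
        by (simp add: t_def fun_eq_iff)
      then show ?case
        using computable_add[OF Suc computable_sum_lessThan[OF computable_compose[OF g computable_p2[OF computable_id]]
            computable_Suc[OF computable_id]]] by simp
    qed
    show "mono (t e)" for e
      unfolding t_def by (intro monoI sum_mono sum_mono2) auto
    show "t e n \<le> t e' n" if "e \<le> e'" for e e' n
      unfolding t_def using that by (intro sum_mono2) auto
    show "\<exists>e. \<forall>n. f n \<le> t e n" if f: "computable f" for f
    proof -
      obtain i where i: "g i = f"
        using from_nat_into_surj[OF count, of f] f unfolding g_def by auto
      have "f n \<le> t i n" for n
      proof -
        have "f n \<le> (\<Sum>k<Suc n. g i k)" using i by simp
        also have "\<dots> \<le> t i n" unfolding t_def by simp
        finally show ?thesis .
      qed
      then show ?thesis by blast
    qed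
  qed
qed

lemma exists_ce_enumeration:
  obtains W :: "nat \<Rightarrow> bitstring set" where "\<And>e. ce_set (W e)" "\<And>V. ce_set V \<Longrightarrow> \<exists>e. V = W e"
proof -
  have "{V. ce_set V} \<subseteq> range (\<lambda>p. {\<sigma>. \<exists>s y. runs p (str_code \<sigma>) s y})"
  proof safe
    fix V assume "ce_set V"
    then obtain M p where "implements p M" "V = dom M"
      unfolding ce_set_def partial_computable_def by blast
    then have "V = {\<sigma>. \<exists>s y. runs p (str_code \<sigma>) s y}"
      unfolding implements_def dom_def by (auto, metis str_code_S)
    then show "V \<in> range (\<lambda>p. {\<sigma>. \<exists>s y. runs p (str_code \<sigma>) s y})" by blast
  qed
  then have count: "countable {V. ce_set V}" by (rule countable_subset) simp
  \<comment> \<open>A search that never succeeds is a machine, so the family is nonempty, as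
    \<open>from_nat_into\<close> requires.\<close>
  have "dec (\<lambda>z. False)" by (rule dec_const)
  then have "\<exists>M. partial_computable M"
    using partial_computable_search[of "\<lambda>_ _. False", OF _ computable_id] by blast
  then have ne: "{V. ce_set V} \<noteq> {}" unfolding ce_set_def by blast
  show thesis
    by (rule that[of "from_nat_into {V. ce_set V}"])
      (use from_nat_into[OF ne] from_nat_into_surj[OF count] in blast)+
qed

theorem theorem1p5:
  fixes U :: "bitstring \<rightharpoonup> bitstring" and u :: prog
  assumes "optimal U" and "implements u U"
  shows "\<exists>A :: nat set. deep U u A \<and> one_generic A"
proof -
  obtain t :: "nat \<Rightarrow> nat \<Rightarrow> nat" where t: "\<And>e. computable (t e)" "\<And>e. mono (t e)"
    "\<And>e e' n. e \<le> e' \<Longrightarrow> t e n \<le> t e' n" "\<And>f. computable f \<Longrightarrow> \<exists>e. \<forall>n. f n \<le> t e n"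
    using exists_monotone_bounds by blast
  obtain W :: "nat \<Rightarrow> bitstring set" where W: "\<And>e. ce_set (W e)" "\<And>V. ce_set V \<Longrightarrow> \<exists>e. V = W e"
    using exists_ce_enumeration by blast
  have start: "\<exists>\<sigma>. controlled U u (t 0) 0 \<sigma>"
  proof -
    obtain C where C: "\<And>j \<sigma>. C \<le> j \<Longrightarrow> length \<sigma> = pos0 j \<Longrightarrow>
        \<exists>\<beta>. length \<beta> = 2 * j \<and> controlled U u (t 0) 0 (\<sigma> @ \<beta>)"
      using exists_controlled[OF assms t(1,2)] by blast
    show ?thesis using C[of C "replicate (pos0 C) False"] by auto
  qed
  \<comment> \<open>Stage \<open>e\<close> works with bound \<open>t e\<close> and gap
    \<open>e\<close> and hands over to \<open>t (Suc e)\<close> and \<open>Suc e\<close>, so every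
    computable bound and every constant is eventually covered.\<close>
  have step: "\<exists>\<sigma>'. controlled U u (t (Suc e)) (Suc e) \<sigma>' \<and> (prefix \<sigma> \<sigma>' \<and> length \<sigma> < length \<sigma>' \<and>
      (\<forall>y. prefix \<sigma> y \<longrightarrow> prefix y \<sigma>' \<longrightarrow> good U u (t e) e y) \<and> decides \<sigma>' (W e))"
    if "controlled U u (t e) e \<sigma>" for \<sigma> e
    using exists_deciding_extension[OF assms t(1,2) t(1,2) t(3) W(1) that, of "Suc e" e] by auto
  obtain f where f: "\<And>e. prefix (f e) (f (Suc e))" "\<And>e. length (f e) < length (f (Suc e))"
    "\<And>e y. prefix (f e) y \<Longrightarrow> prefix y (f (Suc e)) \<Longrightarrow> good U u (t e) e y"
    "\<And>e. decides (f (Suc e)) (W e)"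
    using dependent_nat_choice[of "\<lambda>e. controlled U u (t e) e"
        "\<lambda>e \<sigma> \<sigma>'. prefix \<sigma> \<sigma>' \<and> length \<sigma> < length \<sigma>' \<and>
          (\<forall>y. prefix \<sigma> y \<longrightarrow> prefix y \<sigma>' \<longrightarrow> good U u (t e) e y) \<and> decides \<sigma>' (W e)",
        OF start step] by metis
  have chain: "prefix (f e) (f e')" if "e \<le> e'" for e e'
    using that by (induction rule: dec_induct) (auto intro: prefix_order.trans f(1))
  have len: "e \<le> length (f e)" for e
  proof (induction e)
    case (Suc e)
    then show ?case using f(2)[of e] by simp
  qed simp

  define A where "A = {i. \<exists>e. nthb (f e) i}"
  have A_iff: "i \<in> A \<longleftrightarrow> nthb (f e) i" if "i < length (f e)" for i e
  proof
    assume "i \<in> A"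
    then obtain e' where e': "nthb (f e') i" by (auto simp: A_def)
    show "nthb (f e) i"
    proof (cases "e \<le> e'")
      case True
      then show ?thesis using chain[OF True] e' that by (auto simp: prefix_iff_nthb)
    next
      case False
      then have "prefix (f e') (f e)" by (intro chain) simp
      moreover have "i < length (f e')" using e' by (simp add: nthb_def)
      ultimately show ?thesis using e' by (auto simp: prefix_iff_nthb)
    qed
  qed (auto simp: A_def)
  have length_restr: "length (restr A n) = n" for n by (simp add: restr_def)
  have nthb_restr: "nthb (restr A n) i \<longleftrightarrow> i < n \<and> i \<in> A" for n i
    by (auto simp: nthb_def restr_def)
  have restr_f: "prefix (restr A n) (f e)" if "n \<le> length (f e)" for n e
    using that A_iff by (auto simp: prefix_iff_nthb nthb_restr length_restr)
  have f_restr: "prefix (f e) (restr A n)" if "length (f e) \<le> n" for n e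
    using that A_iff by (auto simp: prefix_iff_nthb nthb_restr length_restr)

  have "deep U u A"
    unfolding deep_def
  proof (intro allI impI)
    fix h c assume "computable h"
    then obtain i where i: "\<And>n. h n \<le> t i n" using t(4) by blast
    have "K_time u h (restr A n) \<ge> K U (restr A n) + enat c" if n: "length (f (i + c)) \<le> n" for n
    proof -
      \<comment> \<open>The stage in charge of length \<open>n\<close>:
        \<open>length (f e) \<le> n < length (f (Suc e))\<close>. From \<open>i + c \<le> e\<close>
        follow both that \<open>t e\<close> dominates \<open>h\<close> and that the gap is at least
        \<open>c\<close>.\<close>
      define e where "e = (LEAST k. n < length (f (Suc k)))"
      have e: "n < length (f (Suc e))" unfolding e_def
        by (rule LeastI[of _ n]) (use len[of "Suc n"] in simp)
      then have "i + c \<le> e"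
        using n prefix_length_le[OF chain[of "Suc e" "i + c"]] by (cases "i + c \<le> e") auto
      have "length (f e) \<le> n"
      proof (cases "e = i + c")
        case True
        then show ?thesis using n by simp
      next
        case False
        with \<open>i + c \<le> e\<close> obtain k where k: "e = Suc k" by (cases e) auto
        then have "k < e" by simp
        then have "\<not> n < length (f (Suc k))" unfolding e_def by (rule not_less_Least)
        then show ?thesis using k by simp
      qed
      then have "good U u (t e) e (restr A n)"
        using f(3) f_restr restr_f e by simp
      moreover have "h (length (restr A n)) \<le> t e (length (restr A n))"
        using i t(3)[of i e] \<open>i + c \<le> e\<close> by (meson add_leD1 order_trans)
      ultimately have "good U u h c (restr A n)"
        using good_mono[of U u "t e" e "restr A n" c h] \<open>i + c \<le> e\<close> by simp
      then show ?thesis by (simp add: good_def)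
    qed
    then show "\<forall>\<^sub>F n in sequentially. K_time u h (restr A n) \<ge> K U (restr A n) + enat c"
      unfolding eventually_sequentially by blast
  qed
  moreover have "one_generic A"
    unfolding one_generic_def
  proof (intro allI impI)
    fix V assume "ce_set V"
    then obtain e where V: "V = W e" using W(2) by blast
    \<comment> \<open>As \<open>f (Suc e)\<close> is an initial segment of \<open>A\<close>, its
      decision about \<open>W e\<close> carries over to \<open>A\<close>.\<close>
    have f_eq: "restr A (length (f (Suc e))) = f (Suc e)"
      using restr_f f_restr by (simp add: prefix_order.antisym)
    show "meets A V \<or> avoids A V"
      using f(4)[of e] unfolding decides_def
    proof
      assume "\<exists>\<rho>\<in>W e. prefix \<rho> (f (Suc e))"
      then obtain \<rho> where \<rho>: "\<rho> \<in> V" "prefix \<rho> (f (Suc e))" using V by blast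
      have "prefix (restr A (length \<rho>)) \<rho>"
        using prefix_length_prefix[OF restr_f \<rho>(2)] prefix_length_le[OF \<rho>(2)] by (simp add: length_restr)
      then have "restr A (length \<rho>) = \<rho>"
        using prefix_length_less[of "restr A (length \<rho>)" \<rho>] by (auto simp: strict_prefix_def length_restr)
      then show ?thesis using \<rho>(1) by (auto simp: meets_def intro: exI[of _ "length \<rho>"])
    next
      assume "\<forall>\<tau>. prefix (f (Suc e)) \<tau> \<longrightarrow> \<tau> \<notin> W e"
      then show ?thesis using f_eq V unfolding avoids_def by metis
    qed
  qed
  ultimately show ?thesis by blast
qed

end
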